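(* Let $(g^*,u^*,x^*,\lambda^* )$ be an optimal primal-dual solution of the economic dispatch problem $$\min_{g,u\in\mathbb{R}^T,\;x\in\mathbb{R}^{T+1}}\ \alpha_g g^Tg+\beta_g\mathbf 1^Tg+C_s(x)\quad\text{s.t.}\quad \underline g\le g_t\le\overline g\ (t=1,\dots,T),\quad (u,x)\in\mathcal S,\quad D+u=g ,$$ that is, $(g^*,u^*,x^* )$ is optimal for this problem and $\lambda^*\in\mathbb{R}^T$ is an optimal solution of the dual problem $\max_\lambda\mathcal D(\lambda)$ obtained by relaxing the power balance constraint $D+u=g$, where $$\mathcal D(\lambda)=\min\{\alpha_g g^Tg+\beta_g\mathbf 1^Tg+C_s(x)+\lambda^T(D+u-g)\;:\;\underline g\le g_t\le\overline g\ \forall t,\ (u,x)\in\mathcal S\}.$$ Then, with the prices $p=\lambda^*$, $g^*$ is optimal for the generator subproblem $$\max_g\ p^Tg-\alpha_g g^Tg-\beta_g\mathbf 1^Tg\quad\text{s.t.}\quad \underline g\le g_t\le\overline g\ (t=1,\dots,T),$$ and $(u^*,x^* )$ is optimal for the storage subproblem $$\max_{u,x}\ -p^Tu-C_s(x)\quad\text{s.t.}\quad (u,x)\in\mathcal S .$$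
   Context: Setting. $T\ge1$ is an integer; $\alpha_g,\beta_g>0$; $\underline g\le\overline g$ are reals; $D\in\mathbb{R}^T$ is a fixed demand; $E>0$ is the storage capacity; $\underline u\le\overline u$ are reals; $x_o\in[0,1]$; $B>0$; $\alpha_b>0$, $\beta_b>1$. Vectors in $\mathbb{R}^{T+1}$ are indexed $x=(x_0,\dots,x_T)$. $\mathbf 1$ is the all-ones vector. $\mathcal S$ is the set of $(u,x)\in\mathbb{R}^T\times\mathbb{R}^{T+1}$ with $0\le x_t\le1$ for $t=0,\dots,T$; $\underline u\le u_t\le\overline u$ and $x_t=x_{t-1}+u_t/E$ for $t=1,\dots,T$; and $x_0=x_T=x_o$. Cycling cost: $C_s(x)=BE\sum_{i=1}^T\Phi(d_i)$ with $\Phi(s)=\frac{\alpha_b}{2}s^{\beta_b}$, where $d=d(x)\in\mathbb{R}^T$ is the vector of half-cycle depths produced from $x$ by the following Rainflow procedure. For a finite set $S$ of time indices, $S[j]$ is its $j$-th smallest element and $x_S(j)=x_{S[j]}$. (1) Switching times: $S_r$ consists of $0$, $T$, and all $t\in\{1,\dots,T-1\}$ at which $x$ changes direction, i.e. $x_t\ne x_{t-1}$ and the first nonzero increment $x_{s+1}-x_s$ with $s\ge t$ exists and has sign opposite to $x_t-x_{t-1}$. (2) Full cycles: while $|S_r|>3$ and there is $j\in\{2,\dots,|S_r|-2\}$ with $\Delta_{j-1}\ge\Delta_j$ and $\Delta_{j+1}\ge\Delta_j$, where $\Delta_i=|x_{S_r}(i+1)-x_{S_r}(i)|$, take the smallest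 such $j$, append $\Delta_j$ twice to $d$ (one charging and one discharging half-cycle), and remove $S_r[j],S_r[j+1]$ from $S_r$. (3) Residual half-cycles: for $j=1,\dots,|S_r|-1$ append $|x_{S_r}(j+1)-x_{S_r}(j)|$ to $d$. Finally pad $d$ with zeros to length $T$. *)

theory Defs
  imports Complex_Main
begin

text \<open>
  Vectors in $R^T$ are functions on \<^typ>\<open>nat\<close> of which only the entries $1, \dots, T$ are
  ever inspected; vectors in $R^{T+1}$ likewise with entries $0, \dots, T$.
\<close>

section \<open>Rainflow half-cycle depths\<close>

definition direction_change :: "nat \<Rightarrow> (nat \<Rightarrow> real) \<Rightarrow> nat \<Rightarrow> bool" where
  "direction_change T x t \<longleftrightarrow> x t \<noteq> x (t - 1) \<and>
     (\<exists>s. t \<le> s \<and> s < T \<and> x (s + 1) \<noteq> x s \<and> (\<forall>r. t \<le> r \<and> r < s \<longrightarrow> x (r + 1) = x r) \<and>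
          sgn (x (s + 1) - x s) = - sgn (x t - x (t - 1)))"

definition switching_times :: "nat \<Rightarrow> (nat \<Rightarrow> real) \<Rightarrow> nat set" where
  "switching_times T x = {0, T} \<union> {t \<in> {1..T - 1}. direction_change T x t}"

text \<open>The $j$-th smallest element $S[j]$; positions are counted from 1.\<close>

definition nth_smallest :: "nat set \<Rightarrow> nat \<Rightarrow> nat" where
  "nth_smallest S j = sorted_list_of_set S ! (j - 1)"

definition swing :: "(nat \<Rightarrow> real) \<Rightarrow> nat set \<Rightarrow> nat \<Rightarrow> real" where
  "swing x S i = \<bar>x (nth_smallest S (i + 1)) - x (nth_smallest S i)\<bar>"

definition full_cycle_at :: "(nat \<Rightarrow> real) \<Rightarrow> nat set \<Rightarrow> nat \<Rightarrow> bool" where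
  "full_cycle_at x S j \<longleftrightarrow> j \<in> {2..card S - 2} \<and>
     swing x S (j - 1) \<ge> swing x S j \<and> swing x S (j + 1) \<ge> swing x S j"

function rainflow :: "(nat \<Rightarrow> real) \<Rightarrow> nat set \<Rightarrow> real list" where
  "rainflow x S =
     (if card S > 3 \<and> (\<exists>j. full_cycle_at x S j)
      then let j = (LEAST j. full_cycle_at x S j)
           in [swing x S j, swing x S j] @ rainflow x (S - {nth_smallest S j, nth_smallest S (j + 1)})
      else map (swing x S) [1..<card S])"
  by pat_completeness auto

termination
proof (relation "measure (\<lambda>(x, S). card S)")
  fix x :: "nat \<Rightarrow> real" and S :: "nat set" and j :: nat
  assume asm: "card S > 3 \<and> (\<exists>j. full_cycle_at x S j)" and j: "j = (LEAST j. full_cycle_at x S j)"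
  have "full_cycle_at x S j"
    unfolding j using asm by (metis LeastI)
  then have "j - 1 < card S"
    using asm by (auto simp: full_cycle_at_def)
  moreover have fin: "finite S"
    using asm by (metis card.infinite not_less_zero)
  ultimately have "nth_smallest S j \<in> S"
    unfolding nth_smallest_def
    by (metis length_sorted_list_of_set nth_mem set_sorted_list_of_set)
  then show "((x, S - {nth_smallest S j, nth_smallest S (j + 1)}), (x, S))
      \<in> measure (\<lambda>(x, S). card S)"
    using fin by (auto intro!: psubset_card_mono)
qed simp

declare rainflow.simps [simp del]

text \<open>
  At most $T$ half-cycles are produced (each removed pair of time indices yields two of them), so
  padding with zeros gives a list of length exactly $T$.
\<close>

definition half_cycle_depths :: "nat \<Rightarrow> (nat \<Rightarrow> real) \<Rightarrow> real list" where
  "half_cycle_depths T x =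
     (let d = rainflow x (switching_times T x) in d @ replicate (T - length d) 0)"

section \<open>Costs, constraints and the dual function\<close>

definition cycle_stress :: "real \<Rightarrow> real \<Rightarrow> real \<Rightarrow> real" where
  "cycle_stress \<alpha>\<^sub>b \<beta>\<^sub>b s = \<alpha>\<^sub>b / 2 * s powr \<beta>\<^sub>b"

definition cycling_cost :: "nat \<Rightarrow> real \<Rightarrow> real \<Rightarrow> real \<Rightarrow> real \<Rightarrow> (nat \<Rightarrow> real) \<Rightarrow> real" where
  "cycling_cost T B E \<alpha>\<^sub>b \<beta>\<^sub>b x =
     B * E * (\<Sum>i = 1..T. cycle_stress \<alpha>\<^sub>b \<beta>\<^sub>b (half_cycle_depths T x ! (i - 1)))"

definition generation_cost :: "nat \<Rightarrow> real \<Rightarrow> real \<Rightarrow> (nat \<Rightarrow> real) \<Rightarrow> real" where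
  "generation_cost T \<alpha>\<^sub>g \<beta>\<^sub>g g = \<alpha>\<^sub>g * (\<Sum>t = 1..T. g t * g t) + \<beta>\<^sub>g * (\<Sum>t = 1..T. g t)"

definition generator_set :: "nat \<Rightarrow> real \<Rightarrow> real \<Rightarrow> (nat \<Rightarrow> real) set" where
  "generator_set T g_lo g_hi = {g. \<forall>t\<in>{1..T}. g_lo \<le> g t \<and> g t \<le> g_hi}"

definition storage_set ::
    "nat \<Rightarrow> real \<Rightarrow> real \<Rightarrow> real \<Rightarrow> real \<Rightarrow> ((nat \<Rightarrow> real) \<times> (nat \<Rightarrow> real)) set" where
  "storage_set T E u_lo u_hi x\<^sub>o = {(u, x).
     (\<forall>t\<in>{0..T}. 0 \<le> x t \<and> x t \<le> 1) \<and>
     (\<forall>t\<in>{1..T}. u_lo \<le> u t \<and> u t \<le> u_hi \<and> x t = x (t - 1) + u t / E) \<and>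
     x 0 = x\<^sub>o \<and> x T = x\<^sub>o}"

text \<open>
  The minimum defining the dual function is written as an infimum of reals. The objective is
  bounded below on the set concerned, so this is the genuine infimum whenever the set is nonempty.
\<close>

definition dual_function ::
    "nat \<Rightarrow> real \<Rightarrow> real \<Rightarrow> real \<Rightarrow> real \<Rightarrow> (nat \<Rightarrow> real) \<Rightarrow> real \<Rightarrow> real \<Rightarrow> real \<Rightarrow> real \<Rightarrow>
     real \<Rightarrow> real \<Rightarrow> real \<Rightarrow> (nat \<Rightarrow> real) \<Rightarrow> real" where
  "dual_function T \<alpha>\<^sub>g \<beta>\<^sub>g g_lo g_hi D E u_lo u_hi x\<^sub>o B \<alpha>\<^sub>b \<beta>\<^sub>b l =
     Inf {generation_cost T \<alpha>\<^sub>g \<beta>\<^sub>g g + cycling_cost T B E \<alpha>\<^sub>b \<beta>\<^sub>b x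
            + (\<Sum>t = 1..T. l t * (D t + u t - g t)) | g u x.
          g \<in> generator_set T g_lo g_hi \<and> (u, x) \<in> storage_set T E u_lo u_hi x\<^sub>o}"

end

(*
  For c >= 0, the sum of (d - c)_+ over the rainflow half-cycle depths d of a path x is the truncated
  variation of x at level c: removing a full cycle of depth b lowers both quantities by 2 (b - c)_+,
  and on the residue, whose swings grow and then shrink, they agree. The truncated variation is
  computed by a dynamic program made of maxima of affine functions of x, so it is convex and
  Lipschitz in x. On any finite set of depths the convex stress function is a nonnegative combination
  of hinges (s - c)_+, so the cycling cost is convex and Lipschitz.

  The dispatch problem is therefore a convex programme on a compact set with affine coupling
  constraints. Quadratic penalization yields multipliers whose dual value comes arbitrarily close to
  the primal optimum, so an optimal dual solution attains it. The primal optimum then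
  minimizes the Lagrangian at these prices, and the Lagrangian separates into the two subproblems.
*)
theory Submission
  imports Defs "HOL-Analysis.Convex" "HOL-Analysis.Elementary_Normed_Spaces"
begin

section \<open>Truncated variation\<close>

text \<open>The number of depths and the pairing of turning points jump as \<open>x\<close> varies,
  so convexity cannot be read off the Rainflow procedure itself. The truncated variation removes
  this obstacle: it is computed from all unit increments and never mentions turning points or
  cycles. The weights of the hinges depend on the depths that occur, hence on the paths being
  compared; convexity compares three paths at once and therefore needs one common set of weights,
  while continuity needs a bound on the total weight that is uniform over paths. On the duality side
  no constraint qualification is assumed, so exact multipliers are not constructed. Attainment of
  the dual maximum is a hypothesis, and only the absence of a duality gap remains to be shown;
  convexity, continuity of the cost and compactness in the relevant coordinates give it.\<close>

text \<open>
  Dynamic program for trading along a price path at cost \<open>c\<close> per trade: \<open>U\<close> and \<open>L\<close> are the best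
  profits so far among strategies that end long or short, \<open>N\<close> the best profit overall, and \<open>d\<close> is
  the next price increment. The optimal profit is the truncated variation
  \<open>sup (\<Sum>i. max 0 (\<bar>x (t (i + 1)) - x (t i)\<bar> - c))\<close>.
\<close>

definition tv_step :: "real \<Rightarrow> real \<Rightarrow> real \<times> real \<times> real \<Rightarrow> real \<times> real \<times> real" where
  "tv_step c d = (\<lambda>(U, L, N). let n = max N (max (U + d) (L - d))
     in (max (U + d) (n - c), max (L - d) (n - c), n))"

text \<open>Invariant of the program: the best strategy can always be followed by one more trade at
  cost \<open>c\<close>, and a strategy holding a position never beats the best one overall. It
  makes most branches of the maxima in a step dominated.\<close>

definition tv_valid :: "real \<Rightarrow> real \<times> real \<times> real \<Rightarrow> bool" where
  "tv_valid c = (\<lambda>(U, L, N). N - c \<le> U \<and> U \<le> N \<and> N - c \<le> L \<and> L \<le> N)"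

definition tv_shift :: "real \<Rightarrow> real \<times> real \<times> real \<Rightarrow> real \<times> real \<times> real" where
  "tv_shift k = (\<lambda>(U, L, N). (U + k, L + k, N + k))"

lemma tv_step_valid: "0 \<le> c \<Longrightarrow> tv_valid c s \<Longrightarrow> tv_valid c (tv_step c d s)"
  by (cases s) (auto simp: tv_valid_def tv_step_def Let_def)

lemma fold_tv_step_valid: "0 \<le> c \<Longrightarrow> tv_valid c s \<Longrightarrow> tv_valid c (fold (tv_step c) ds s)"
  by (induction ds arbitrary: s) (auto simp: tv_step_valid)

lemma tv_step_shift: "tv_step c d (tv_shift k s) = tv_shift k (tv_step c d s)"
  by (cases s) (auto simp: tv_shift_def tv_step_def Let_def max_def)

lemma fold_tv_step_shift: "fold (tv_step c) ds (tv_shift k s) = tv_shift k (fold (tv_step c) ds s)"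
  by (induction ds arbitrary: s) (auto simp: tv_step_shift)

lemma tv_step_nonneg:
  assumes "0 \<le> c" "tv_valid c (U, L, N)" "0 \<le> d"
  shows "tv_step c d (U, L, N) = (U + d, max (L - d) (max N (U + d) - c), max N (U + d))"
  using assms by (auto simp: tv_valid_def tv_step_def Let_def max_def)

lemma tv_step_nonpos:
  assumes "0 \<le> c" "tv_valid c (U, L, N)" "d \<le> 0"
  shows "tv_step c d (U, L, N) = (max (U + d) (max N (L - d) - c), L - d, max N (L - d))"
  using assms by (auto simp: tv_valid_def tv_step_def Let_def max_def)

text \<open>On a monotone stretch, trading at an intermediate point gains nothing. This is what lets
  the program be run on unit increments or on swings between turning points with the same
  result.\<close>

lemma tv_step_merge:
  assumes "0 \<le> c" "tv_valid c s" "0 \<le> a \<and> 0 \<le> b \<or> a \<le> 0 \<and> b \<le> 0"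
  shows "tv_step c b (tv_step c a s) = tv_step c (a + b) s"
proof -
  obtain U L N where s: "s = (U, L, N)" by (cases s)
  note v = tv_step_valid[OF assms(1,2), of a]
  from assms(3) show ?thesis
  proof
    assume ab: "0 \<le> a \<and> 0 \<le> b"
    show ?thesis using assms(1,2) v ab
      by (simp add: s tv_step_nonneg) (auto simp: max_def tv_valid_def)
  next
    assume ab: "a \<le> 0 \<and> b \<le> 0"
    show ?thesis using assms(1,2) v ab
      by (simp add: s tv_step_nonpos) (auto simp: max_def tv_valid_def)
  qed
qed

text \<open>Reflecting the prices exchanges long and short positions, so falling cycles reduce to
  rising ones.\<close>

definition tv_swap :: "real \<times> real \<times> real \<Rightarrow> real \<times> real \<times> real" where
  "tv_swap = (\<lambda>(U, L, N). (L, U, N))"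

lemma tv_step_swap: "tv_step c (- d) (tv_swap s) = tv_swap (tv_step c d s)"
  by (cases s) (auto simp: tv_swap_def tv_step_def Let_def max.commute)

text \<open>If \<open>c \<le> b\<close>, it pays to go short for the dip: compared with riding
  through it, a loss of \<open>b\<close> becomes a gain of \<open>b\<close> at the price of two
  trades, hence \<open>2 * (b - c)\<close>. A smaller dip is not worth trading and leaves no trace
  in the state once the second rise has passed.\<close>

lemma tv_step_cycle_up:
  assumes "0 \<le> c" "tv_valid c s" and b: "0 \<le> b" "b \<le> a" "b \<le> e"
  shows "tv_step c e (tv_step c (- b) (tv_step c a s)) = tv_shift (2 * max 0 (b - c)) (tv_step c (a - b + e) s)"
proof -
  obtain U L N where s: "s = (U, L, N)" by (cases s)
  have v: "N - c \<le> U" "U \<le> N" "N - c \<le> L" "L \<le> N"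
    using assms s by (auto simp: tv_valid_def)
  have v1: "tv_valid c (tv_step c a s)" and v2: "tv_valid c (tv_step c (- b) (tv_step c a s))"
    using assms tv_step_valid by blast+
  show ?thesis
  proof (cases "c \<le> b")
    case True
    \<comment> \<open>As \<open>c\<close> is at most \<open>b\<close>, and \<open>b\<close> at most
      \<open>a\<close> and \<open>e\<close>, every one of the three swings is large enough to pay
      for a trade, so each maximum is decided in favour of the current swing.\<close>
    have 1: "tv_step c a s = (U + a, U + a - c, U + a)"
      using v True assms s by (simp add: tv_step_nonneg max_absorb2)
    have 2: "tv_step c (- b) (tv_step c a s) = (U + a - 2 * c + b, U + a - c + b, U + a - c + b)"
      using v1 True assms unfolding 1 by (simp add: tv_step_nonpos max_absorb2)
    have 3: "tv_step c e (tv_step c (- b) (tv_step c a s)) =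
        (U + a - 2 * c + b + e, U + a - 3 * c + b + e, U + a - 2 * c + b + e)"
      using v2 True assms unfolding 2 by (simp add: tv_step_nonneg max_absorb2)
    have 4: "tv_step c (a - b + e) s = (U + a - b + e, U + a - b + e - c, U + a - b + e)"
      using v True assms s by (simp add: tv_step_nonneg max_absorb2)
    show ?thesis using True unfolding 3 4 by (simp add: tv_shift_def)
  next
    case False
    define M where "M = max N (U + a)"
    define K where "K = max (L - a) (M - c)"
    have 1: "tv_step c a s = (U + a, K, M)"
      using assms s by (simp add: tv_step_nonneg K_def M_def)
    \<comment> \<open>A dip below \<open>c\<close> sets no new record: the short position stays
      below \<open>M\<close> even after gaining \<open>b\<close>, and remaining long is no worse
      than buying in again.\<close>
    have "K + b \<le> M" "M - c \<le> U + a - b"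
      using v b False by (auto simp: K_def M_def)
    then have 2: "tv_step c (- b) (tv_step c a s) = (U + a - b, K + b, M)"
      using v1 b assms unfolding 1 by (simp add: tv_step_nonpos max_absorb1)
    have 3: "tv_step c e (tv_step c (- b) (tv_step c a s)) =
        (U + a - b + e, max (K + b - e) (max M (U + a - b + e) - c), max M (U + a - b + e))"
      using v2 assms unfolding 2 by (simp add: tv_step_nonneg)
    have 4: "max M (U + a - b + e) = max N (U + a - b + e)"
      using b by (auto simp: M_def)
    have 5: "max (K + b - e) (max N (U + a - b + e) - c) = max (L - (a - b + e)) (max N (U + a - b + e) - c)"
      using b 4 by (auto simp: K_def)
    have 6: "U + a - b + e = U + (a - b + e)" by simp
    show ?thesis using False b assms unfolding 3 4 5 unfolding 6
      by (simp add: s tv_step_nonneg tv_shift_def)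
  qed
qed

lemma tv_step_cycle_down:
  assumes "0 \<le> c" "tv_valid c s" "0 \<le> b" "b \<le> a" "b \<le> e"
  shows "tv_step c (- e) (tv_step c b (tv_step c (- a) s)) = tv_shift (2 * max 0 (b - c)) (tv_step c (- (a - b + e)) s)"
proof -
  have swap: "tv_swap (tv_swap s) = s" for s by (cases s) (simp add: tv_swap_def)
  have shift: "tv_swap (tv_shift k s) = tv_shift k (tv_swap s)" for k s
    by (cases s) (simp add: tv_swap_def tv_shift_def)
  have "tv_valid c (tv_swap s)" using assms by (auto simp: tv_valid_def tv_swap_def)
  from tv_step_cycle_up[OF assms(1) this assms(3-5)]
  have "tv_swap (tv_step c e (tv_step c (- b) (tv_step c a (tv_swap s)))) =
      tv_swap (tv_shift (2 * max 0 (b - c)) (tv_step c (a - b + e) (tv_swap s)))" by simp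
  then show ?thesis
    unfolding shift tv_step_swap[symmetric] swap by simp
qed

section \<open>Excising a full cycle from a list of values\<close>

fun increments :: "real list \<Rightarrow> real list" where
  "increments (v # w # vs) = (w - v) # increments (w # vs)"
| "increments _ = []"

lemma increments_append: "increments (xs @ v # ys) = increments (xs @ [v]) @ increments (v # ys)"
  by (induction xs rule: increments.induct) auto

lemma length_increments: "length (increments vs) = length vs - 1"
  by (induction vs rule: increments.induct) auto

lemma nth_increments: "Suc i < length vs \<Longrightarrow> increments vs ! i = vs ! Suc i - vs ! i"
proof (induction vs arbitrary: i rule: increments.induct)
  case (1 v w vs)
  then show ?case by (cases i) auto
qed auto

text \<open>The signs are weak because a constant path still has the two switching times
  \<open>0\<close> and \<open>T\<close>, with a zero swing between them.\<close>

fun alternating :: "bool \<Rightarrow> real list \<Rightarrow> bool" where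
  "alternating up [] = True"
| "alternating up (d # ds) = ((if up then 0 \<le> d else d \<le> 0) \<and> alternating (\<not> up) ds)"

lemma alternating_append:
  "alternating up (xs @ ys) \<longleftrightarrow> alternating up xs \<and> alternating (up \<longleftrightarrow> even (length xs)) ys"
  by (induction xs arbitrary: up) auto

text \<open>The increments before the cycle only produce a valid state, and the gain from the cycle
  passes unchanged through the later ones because every step commutes with
  \<open>tv_shift\<close>.\<close>

lemma tv_cycle_removal:
  assumes c: "0 \<le> c" "tv_valid c s"
    and alt: "alternating up (increments (ps @ [p, q, r, t] @ qs))"
    and d: "\<bar>r - q\<bar> \<le> \<bar>q - p\<bar>" "\<bar>r - q\<bar> \<le> \<bar>t - r\<bar>"
  shows "alternating up (increments (ps @ [p, t] @ qs))"
    and "fold (tv_step c) (increments (ps @ [p, q, r, t] @ qs)) s =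
      tv_shift (2 * max 0 (\<bar>r - q\<bar> - c)) (fold (tv_step c) (increments (ps @ [p, t] @ qs)) s)"
proof -
  have l: "increments (ps @ [p, q, r, t] @ qs) =
      increments (ps @ [p]) @ [q - p, r - q, t - r] @ increments (t # qs)"
    using increments_append[of ps p "q # r # t # qs"] by simp
  have r: "increments (ps @ [p, t] @ qs) = increments (ps @ [p]) @ [t - p] @ increments (t # qs)"
    using increments_append[of ps p "t # qs"] by simp
  show "alternating up (increments (ps @ [p, t] @ qs))"
    using alt d unfolding l r alternating_append by (auto split: if_splits)
  define s' where "s' = fold (tv_step c) (increments (ps @ [p])) s"
  have s': "tv_valid c s'" unfolding s'_def using c fold_tv_step_valid by blast
  define up' where "up' = (up \<longleftrightarrow> even (length (increments (ps @ [p]))))"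
  have a: "alternating up' [q - p, r - q, t - r]"
    using alt unfolding l alternating_append up'_def by auto
  have *: "tv_step c (t - r) (tv_step c (r - q) (tv_step c (q - p) s')) =
      tv_shift (2 * max 0 (\<bar>r - q\<bar> - c)) (tv_step c (t - p) s')"
  proof (cases up')
    case True
    then show ?thesis
      using a d tv_step_cycle_up[OF c(1) s', of "q - r" "q - p" "t - r"] by auto
  next
    case False
    then show ?thesis
      using a d tv_step_cycle_down[OF c(1) s', of "r - q" "p - q" "r - t"] by auto
  qed
  show "fold (tv_step c) (increments (ps @ [p, q, r, t] @ qs)) s =
      tv_shift (2 * max 0 (\<bar>r - q\<bar> - c)) (fold (tv_step c) (increments (ps @ [p, t] @ qs)) s)"
    unfolding l r by (simp add: s'_def[symmetric] * fold_tv_step_shift)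
qed

section \<open>Profit from the residual swings\<close>

definition state_gap :: "bool \<Rightarrow> real \<times> real \<times> real \<Rightarrow> real" where
  "state_gap up = (\<lambda>(U, L, N). if up then N - U else N - L)"

lemma state_gap_bounds: "tv_valid c s \<Longrightarrow> 0 \<le> state_gap up s \<and> state_gap up s \<le> c"
  by (cases s) (auto simp: tv_valid_def state_gap_def)

text \<open>A gap is the distance of the favoured position below the best profit, so a swing earns
  only what exceeds it. The swing closes its own gap and widens the opposite one, up to
  \<open>c\<close>, the price of opening that position afresh.\<close>

lemma tv_step_gap:
  assumes "0 \<le> c" "tv_valid c s" "if up then 0 \<le> d else d \<le> 0"
  shows "snd (snd (tv_step c d s)) = snd (snd s) + max 0 (\<bar>d\<bar> - state_gap up s)"
    and "state_gap up (tv_step c d s) = max 0 (state_gap up s - \<bar>d\<bar>)"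
    and "state_gap (\<not> up) (tv_step c d s) =
      min c (state_gap (\<not> up) s + max 0 (\<bar>d\<bar> - state_gap up s) + \<bar>d\<bar>)"
  using assms
  by (cases s; cases up; simp add: tv_step_nonneg tv_step_nonpos state_gap_def, linarith?)+

text \<open>A gap never exceeds \<open>c\<close>, so the last assumption leaves two cases: the gap
  equals \<open>c\<close>, or the swing fits into the gap and earns nothing, just as its hinge
  vanishes. Each swing leaves an opposite gap of at least \<open>min \<bar>d\<bar> c\<close>, which
  is enough for the smaller swing that follows.\<close>

lemma tv_decreasing_swings:
  assumes "0 \<le> c" "tv_valid c s" "alternating up ds" "sorted_wrt (>) (map abs ds)"
    and "ds \<noteq> [] \<Longrightarrow> min \<bar>hd ds\<bar> c \<le> state_gap up s"
  shows "snd (snd (fold (tv_step c) ds s)) = snd (snd s) + (\<Sum>d\<leftarrow>ds. max 0 (\<bar>d\<bar> - c))"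
  using assms
proof (induction ds arbitrary: s up)
  case (Cons d ds)
  let ?s = "tv_step c d s"
  have d: "if up then 0 \<le> d else d \<le> 0" using Cons.prems by simp
  note g = tv_step_gap[OF Cons.prems(1,2) d]
  have b: "0 \<le> state_gap (\<not> up) s" "state_gap up s \<le> c"
    using state_gap_bounds[OF Cons.prems(2)] by auto
  have "snd (snd (fold (tv_step c) ds ?s)) = snd (snd ?s) + (\<Sum>d\<leftarrow>ds. max 0 (\<bar>d\<bar> - c))"
  proof (rule Cons.IH[of _ "\<not> up"])
    show "min \<bar>hd ds\<bar> c \<le> state_gap (\<not> up) ?s" if "ds \<noteq> []"
    proof -
      have "\<bar>hd ds\<bar> < \<bar>d\<bar>" using Cons.prems(4) that by (cases ds) auto
      then show ?thesis using g(3) b by linarith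
    qed
  qed (use Cons.prems tv_step_valid in auto)
  moreover have "max 0 (\<bar>d\<bar> - state_gap up s) = max 0 (\<bar>d\<bar> - c)"
    using b Cons.prems(5) by auto
  ultimately show ?case using g(1) by simp
qed simp

definition no_full_cycle :: "real list \<Rightarrow> bool" where
  "no_full_cycle ds \<longleftrightarrow> (\<forall>i. Suc (Suc i) < length ds \<longrightarrow>
     \<bar>ds ! i\<bar> < \<bar>ds ! Suc i\<bar> \<or> \<bar>ds ! Suc (Suc i)\<bar> < \<bar>ds ! Suc i\<bar>)"

lemma no_full_cycle_Cons: "no_full_cycle (d # ds) \<Longrightarrow> no_full_cycle ds"
  unfolding no_full_cycle_def by (metis length_Cons not_less_eq nth_Cons_Suc)

text \<open>Once a swing is smaller than its predecessor, the next one must be smaller still, since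
  otherwise the swing between them would be a full cycle.\<close>

lemma no_full_cycle_decreasing:
  "no_full_cycle (d # e # ds) \<Longrightarrow> \<bar>e\<bar> < \<bar>d\<bar> \<Longrightarrow> sorted_wrt (>) (map abs (d # e # ds))"
proof (induction ds arbitrary: d e)
  case (Cons f ds)
  have "\<bar>f\<bar> < \<bar>e\<bar>"
    using Cons.prems unfolding no_full_cycle_def by (auto dest: spec[of _ 0])
  from Cons.IH[OF no_full_cycle_Cons[OF Cons.prems(1)] this] show ?case
    using Cons.prems(2) by auto
qed simp

text \<open>
  Without interior full cycles the swings first grow and then shrink; while they grow, \<open>a\<close> is the
  size of the previous swing.
\<close>

lemma tv_residual_swings:
  assumes "0 \<le> c" "tv_valid c s" "alternating up ds" "no_full_cycle ds" "0 \<le> a"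
    and "ds \<noteq> [] \<Longrightarrow> \<bar>hd ds\<bar> < a \<Longrightarrow> sorted_wrt (>) (map abs ds)"
    and "state_gap up s = c" "state_gap (\<not> up) s = max 0 (c - a)"
  shows "snd (snd (fold (tv_step c) ds s)) = snd (snd s) + (\<Sum>d\<leftarrow>ds. max 0 (\<bar>d\<bar> - c))"
  using assms
proof (induction ds arbitrary: s up a)
  case (Cons d ds)
  show ?case
  proof (cases "\<bar>d\<bar> < a")
    case True
    have "tv_valid c s" "min \<bar>hd (d # ds)\<bar> c \<le> state_gap up s"
      using Cons.prems(2,7) by auto
    with tv_decreasing_swings[OF Cons.prems(1) _ Cons.prems(3)] Cons.prems(6) True
    show ?thesis by simp
  next
    case False
    let ?s = "tv_step c d s"
    have d: "if up then 0 \<le> d else d \<le> 0" using Cons.prems(3) by simp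
    note g = tv_step_gap[OF Cons.prems(1,2) d]
    have dec: "sorted_wrt (>) (map abs ds)" if "ds \<noteq> []" "\<bar>hd ds\<bar> < \<bar>d\<bar>"
    proof -
      obtain e es where ds: "ds = e # es" using \<open>ds \<noteq> []\<close> by (cases ds) auto
      show ?thesis using no_full_cycle_decreasing[of d e es] Cons.prems(4) that unfolding ds by simp
    qed
    \<comment> \<open>The swing is at least \<open>a\<close>, so together with the old opposite gap,
      which is at least \<open>c - a\<close>, it refills that gap to its cap
      \<open>c\<close>.\<close>
    have g1: "state_gap (\<not> up) ?s = c"
      using g(3) Cons.prems(1,5,7,8) False by linarith
    have g2: "state_gap (\<not> \<not> up) ?s = max 0 (c - \<bar>d\<bar>)"
      using g(2) Cons.prems(7) by simp
    have "snd (snd (fold (tv_step c) ds ?s)) = snd (snd ?s) + (\<Sum>d\<leftarrow>ds. max 0 (\<bar>d\<bar> - c))"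
      using Cons.IH[OF Cons.prems(1) tv_step_valid[OF Cons.prems(1,2)] _ no_full_cycle_Cons[OF Cons.prems(4)] abs_ge_zero dec g1 g2]
        Cons.prems(3) by simp
    then show ?thesis using g(1) Cons.prems(7) by simp
  qed
qed simp

section \<open>Rainflow counting computes the truncated variation\<close>

lemma split_list_at_four:
  assumes "i + 3 < length l"
  shows "l = take i l @ [l ! i, l ! (i + 1), l ! (i + 2), l ! (i + 3)] @ drop (i + 4) l"
proof -
  have "drop i l = [l ! i, l ! (i + 1), l ! (i + 2), l ! (i + 3)] @ drop (i + 4) l"
    using assms Cons_nth_drop_Suc[of i l] Cons_nth_drop_Suc[of "i + 1" l]
      Cons_nth_drop_Suc[of "i + 2" l] Cons_nth_drop_Suc[of "i + 3" l] by (simp add: eval_nat_numeral)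
  then show ?thesis by (metis append_take_drop_id)
qed

lemma sorted_list_of_set_split:
  assumes "finite S" "full_cycle_at x S j"
  obtains ps p q r t qs where "sorted_list_of_set S = ps @ [p, q, r, t] @ qs"
    "nth_smallest S j = q" "nth_smallest S (j + 1) = r"
    "sorted_list_of_set (S - {q, r}) = ps @ [p, t] @ qs"
    "swing x S j = \<bar>x r - x q\<bar>" "\<bar>x r - x q\<bar> \<le> \<bar>x q - x p\<bar>" "\<bar>x r - x q\<bar> \<le> \<bar>x t - x r\<bar>"
proof -
  let ?l = "sorted_list_of_set S"
  have j: "2 \<le> j" "j \<le> card S - 2" using assms by (auto simp: full_cycle_at_def)
  \<comment> \<open>Positions count from 1 and \<open>j\<close> is the second of the four times, so
    the first of them has list index \<open>j - 2\<close>.\<close>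
  define i where "i = j - 2"
  have ji: "j = i + 2" using j by (simp add: i_def)
  have "i + 3 < length ?l" using j ji by simp
  note l = split_list_at_four[OF this]
  define ps p q r t qs where "ps = take i ?l" and "p = ?l ! i" and "q = ?l ! (i + 1)"
    and "r = ?l ! (i + 2)" and "t = ?l ! (i + 3)" and "qs = drop (i + 4) ?l"
  note defs = ps_def p_def q_def r_def t_def qs_def
  have l: "?l = ps @ [p, q, r, t] @ qs" using l unfolding defs .
  have d: "distinct (ps @ [p, q, r, t] @ qs)" and st: "sorted (ps @ [p, q, r, t] @ qs)"
    using distinct_sorted_list_of_set[of S] sorted_sorted_list_of_set[of S] unfolding l by blast+
  have S: "S = set (ps @ [p, q, r, t] @ qs)"
    using set_sorted_list_of_set[OF assms(1)] unfolding l by simp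
  have "sorted_list_of_set (S - {q, r}) = ps @ [p, t] @ qs"
  proof (rule sorted_distinct_set_unique)
    show "set (sorted_list_of_set (S - {q, r})) = set (ps @ [p, t] @ qs)"
      using d assms(1) by (simp only: set_sorted_list_of_set finite_Diff) (auto simp: S)
    show "sorted (ps @ [p, t] @ qs)" using st by (auto simp: sorted_append)
    show "distinct (ps @ [p, t] @ qs)" using d by auto
  qed auto
  moreover have "nth_smallest S j = q" "nth_smallest S (j + 1) = r"
    "nth_smallest S (j - 1) = p" "nth_smallest S (j + 1 + 1) = t"
    unfolding nth_smallest_def ji p_def q_def r_def t_def by (simp_all add: eval_nat_numeral)
  moreover from this have "swing x S j = \<bar>x r - x q\<bar>" "swing x S (j - 1) = \<bar>x q - x p\<bar>"
    "swing x S (j + 1) = \<bar>x t - x r\<bar>"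
    using j unfolding swing_def by auto
  ultimately show thesis using that[OF l] assms(2) unfolding full_cycle_at_def by metis
qed

lemma swings_eq_increments:
  "map (swing x S) [1..<card S] = map abs (increments (map x (sorted_list_of_set S)))"
  by (rule nth_equalityI) (auto simp: length_increments nth_increments swing_def nth_smallest_def)

lemma no_full_cycle_increments:
  assumes "\<nexists>j. full_cycle_at x S j"
  shows "no_full_cycle (increments (map x (sorted_list_of_set S)))"
  unfolding no_full_cycle_def
proof (intro allI impI)
  fix i
  assume "Suc (Suc i) < length (increments (map x (sorted_list_of_set S)))"
  then have i: "Suc (Suc (Suc i)) < card S" by (simp add: length_increments)
  have "\<not> full_cycle_at x S (i + 2)" using assms by blast
  then show "\<bar>increments (map x (sorted_list_of_set S)) ! i\<bar> < \<bar>increments (map x (sorted_list_of_set S)) ! Suc i\<bar> \<or>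
      \<bar>increments (map x (sorted_list_of_set S)) ! Suc (Suc i)\<bar> < \<bar>increments (map x (sorted_list_of_set S)) ! Suc i\<bar>"
    using i by (auto simp: full_cycle_at_def swing_def nth_smallest_def nth_increments not_le)
qed

lemma rainflow_residual:
  assumes "\<not> (card S > 3 \<and> (\<exists>j. full_cycle_at x S j))"
  shows "rainflow x S = map (swing x S) [1..<card S]"
  using assms by (subst rainflow.simps) (rule if_not_P)

lemma rainflow_tv:
  assumes "0 \<le> c" "finite S" "alternating up (increments (map x (sorted_list_of_set S)))"
  shows "(\<Sum>d\<leftarrow>rainflow x S. max 0 (d - c)) =
    snd (snd (fold (tv_step c) (increments (map x (sorted_list_of_set S))) (- c, - c, 0)))"
  using assms
proof (induction x S rule: rainflow.induct)
  case (1 x S)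
  have v: "tv_valid c (- c, - c, 0)" using \<open>0 \<le> c\<close> by (simp add: tv_valid_def)
  show ?case
  proof (cases "card S > 3 \<and> (\<exists>j. full_cycle_at x S j)")
    case True
    define j where "j = (LEAST j. full_cycle_at x S j)"
    have "full_cycle_at x S j" unfolding j_def using True by (metis LeastI)
    from sorted_list_of_set_split[OF 1(3) this] obtain ps p q r t qs where
      l: "sorted_list_of_set S = ps @ [p, q, r, t] @ qs"
      and n: "nth_smallest S j = q" "nth_smallest S (j + 1) = r"
      and l': "sorted_list_of_set (S - {q, r}) = ps @ [p, t] @ qs"
      and sw: "swing x S j = \<bar>x r - x q\<bar>"
      and le: "\<bar>x r - x q\<bar> \<le> \<bar>x q - x p\<bar>" "\<bar>x r - x q\<bar> \<le> \<bar>x t - x r\<bar>" by metis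
    have alt: "alternating up (increments (map x ps @ [x p, x q, x r, x t] @ map x qs))"
      using 1(4) unfolding l by simp
    note rem = tv_cycle_removal[OF 1(2) v alt le]
    have "(\<Sum>d\<leftarrow>rainflow x (S - {q, r}). max 0 (d - c)) =
      snd (snd (fold (tv_step c) (increments (map x (sorted_list_of_set (S - {q, r})))) (- c, - c, 0)))"
      using 1(1)[OF True j_def] 1(2,3) rem(1) unfolding n l' by simp
    moreover have "rainflow x S = [\<bar>x r - x q\<bar>, \<bar>x r - x q\<bar>] @ rainflow x (S - {q, r})"
      using True n sw by (subst rainflow.simps) (simp add: Let_def flip: j_def)
    moreover have "snd (snd (tv_shift k s)) = snd (snd s) + k" for k s
      by (cases s) (simp add: tv_shift_def)
    ultimately show ?thesis
      using rem(2) unfolding l l' by simp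
  next
    case False
    \<comment> \<open>A full cycle has a position between \<open>2\<close> and
      \<open>card S - 2\<close>, which forces \<open>card S > 3\<close>; so the failed test rules
      out full cycles altogether.\<close>
    have "\<nexists>j. full_cycle_at x S j"
      using False by (auto simp: full_cycle_at_def)
    note nc = no_full_cycle_increments[OF this]
    have "rainflow x S = map abs (increments (map x (sorted_list_of_set S)))"
      unfolding swings_eq_increments[symmetric] using False by (rule rainflow_residual)
    \<comment> \<open>Both gaps of the initial state equal \<open>c\<close>, which is the invariant
      of \<open>tv_residual_swings\<close> with \<open>a = 0\<close>.\<close>
    then show ?thesis
      using tv_residual_swings[OF 1(2) v 1(4) nc order_refl] 1(2)
      by (simp add: state_gap_def o_def)
  qed
qed

text \<open>A removal takes away two times and emits two depths. The bound obtained from this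
  ensures that the cost, a sum over \<open>T\<close> entries, omits no depth.\<close>

lemma length_rainflow: "finite S \<Longrightarrow> length (rainflow x S) = card S - 1"
proof (induction x S rule: rainflow.induct)
  case (1 x S)
  show ?case
  proof (cases "card S > 3 \<and> (\<exists>j. full_cycle_at x S j)")
    case True
    define j where "j = (LEAST j. full_cycle_at x S j)"
    have "full_cycle_at x S j" unfolding j_def using True by (metis LeastI)
    from sorted_list_of_set_split[OF 1(2) this] obtain ps p q r t qs where
      l: "sorted_list_of_set S = ps @ [p, q, r, t] @ qs"
      and n: "nth_smallest S j = q" "nth_smallest S (j + 1) = r"
      and l': "sorted_list_of_set (S - {q, r}) = ps @ [p, t] @ qs" by metis
    have "length (rainflow x S) = 2 + length (rainflow x (S - {q, r}))"
      using True n by (subst rainflow.simps) (simp add: Let_def flip: j_def)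
    moreover have "length (rainflow x (S - {q, r})) = card (S - {q, r}) - 1"
      using 1(1)[OF True j_def] 1(2) unfolding n by simp
    moreover have "card S = length ps + length qs + 4" "card (S - {q, r}) = length ps + length qs + 2"
      using arg_cong[OF l, of length] arg_cong[OF l', of length] by simp_all
    ultimately show ?thesis by simp
  next
    case False
    show ?thesis unfolding rainflow_residual[OF False] by simp
  qed
qed

lemma nth_smallest_mem: "finite S \<Longrightarrow> 1 \<le> j \<Longrightarrow> j \<le> card S \<Longrightarrow> nth_smallest S j \<in> S"
  unfolding nth_smallest_def
  by (metis Suc_le_lessD Suc_pred length_sorted_list_of_set less_eq_Suc_le nth_mem One_nat_def set_sorted_list_of_set)

text \<open>Serves to confine the depths to the unit interval for paths with values there.\<close>

lemma rainflow_depth: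
  assumes "finite S" "d \<in> set (rainflow x S)"
  obtains a b where "a \<in> S" "b \<in> S" "d = \<bar>x a - x b\<bar>"
  using assms
proof (induction x S arbitrary: thesis rule: rainflow.induct)
  case (1 x S)
  have sw: "\<exists>a\<in>S. \<exists>b\<in>S. swing x S j = \<bar>x a - x b\<bar>" if "1 \<le> j" "j < card S" for j
    using nth_smallest_mem[OF 1(3), of j] nth_smallest_mem[OF 1(3), of "j + 1"] that
    unfolding swing_def by force
  show ?case
  proof (cases "card S > 3 \<and> (\<exists>j. full_cycle_at x S j)")
    case True
    define j where "j = (LEAST j. full_cycle_at x S j)"
    have j: "full_cycle_at x S j" unfolding j_def using True by (metis LeastI)
    let ?S = "S - {nth_smallest S j, nth_smallest S (j + 1)}"
    have "rainflow x S = [swing x S j, swing x S j] @ rainflow x ?S"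
      using True by (subst rainflow.simps) (simp add: Let_def flip: j_def)
    with 1(4) consider "d = swing x S j" | "d \<in> set (rainflow x ?S)" by auto
    then show ?thesis
    proof cases
      case 1
      then show ?thesis using sw[of j] j True "1.prems"(1) unfolding full_cycle_at_def by fastforce
    next
      case 2
      show ?thesis
        using "1.IH"[OF True j_def _ _ 2] "1.prems"(1,2) by blast
    qed
  next
    case False
    then have "rainflow x S = map (swing x S) [1..<card S]" by (rule rainflow_residual)
    with 1(4) obtain j where "1 \<le> j" "j < card S" "d = swing x S j" by auto
    then show ?thesis using sw 1(2) by blast
  qed
qed

section \<open>From switching times to unit increments\<close>

function next_sign :: "nat \<Rightarrow> (nat \<Rightarrow> real) \<Rightarrow> nat \<Rightarrow> real" where
  "next_sign T x k = (if k < T then if x (Suc k) \<noteq> x k then sgn (x (Suc k) - x k)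
     else next_sign T x (Suc k) else 0)"
  by pat_completeness auto
termination by (relation "measure (\<lambda>(T, x, k). T - k)") auto

declare next_sign.simps [simp del]

text \<open>The recursive form suits induction along the path better than the existential one. The
  value 0 is excluded because it encodes that the path does not move any more.\<close>

lemma next_sign_eq_iff:
  "\<sigma> \<noteq> 0 \<Longrightarrow> next_sign T x k = \<sigma> \<longleftrightarrow>
     (\<exists>s. k \<le> s \<and> s < T \<and> x (s + 1) \<noteq> x s \<and> (\<forall>r. k \<le> r \<and> r < s \<longrightarrow> x (r + 1) = x r) \<and>
          sgn (x (s + 1) - x s) = \<sigma>)"
  (is "_ \<Longrightarrow> _ \<longleftrightarrow> (\<exists>s. ?P k s)")
proof (induction T x k rule: next_sign.induct)
  case (1 T x k)
  let ?Q = "\<lambda>k s. k \<le> s \<and> s < T \<and> x (s + 1) \<noteq> x s \<and> (\<forall>r. k \<le> r \<and> r < s \<longrightarrow> x (r + 1) = x r) \<and>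
          sgn (x (s + 1) - x s) = \<sigma>"
  consider "\<not> k < T" | "k < T" "x (Suc k) \<noteq> x k" | "k < T" "x (Suc k) = x k" by blast
  then show ?case
  proof cases
    case 1
    then show ?thesis using \<open>\<sigma> \<noteq> 0\<close> by (subst next_sign.simps) auto
  next
    case 2
    have "s = k" if "?Q k s" for s
      using that 2 by (metis Suc_eq_plus1 le_neq_implies_less order_refl)
    then have "(\<exists>s. ?Q k s) \<longleftrightarrow> ?Q k k" by blast
    moreover have "?Q k k \<longleftrightarrow> sgn (x (Suc k) - x k) = \<sigma>" using 2 by auto
    moreover have "next_sign T x k = sgn (x (Suc k) - x k)" using 2 by (subst next_sign.simps) simp
    ultimately show ?thesis by simp
  next
    case 3
    have "?Q k s \<longleftrightarrow> ?Q (Suc k) s" for s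
    proof
      assume "?Q k s"
      moreover from this have "k \<noteq> s" using 3 by auto
      ultimately show "?Q (Suc k) s" by auto
    next
      assume Q: "?Q (Suc k) s"
      have "x (r + 1) = x r" if "k \<le> r" "r < s" for r
        using Q 3 that by (cases "r = k") auto
      with Q show "?Q k s" by auto
    qed
    then show ?thesis using 1 3 by (subst next_sign.simps) simp
  qed
qed

lemma direction_change_iff:
  "direction_change T x t \<longleftrightarrow> x t \<noteq> x (t - 1) \<and> next_sign T x t = - sgn (x t - x (t - 1))"
  unfolding direction_change_def
  using next_sign_eq_iff[of "- sgn (x t - x (t - 1))" T x t] by (auto simp: sgn_zero_iff)

definition switching_after :: "nat \<Rightarrow> (nat \<Rightarrow> real) \<Rightarrow> nat \<Rightarrow> nat list" where
  "switching_after T x k = filter (\<lambda>t. t \<in> switching_times T x) [Suc k..<Suc T]"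

lemma switching_after_rec:
  assumes "k < T"
  shows "switching_after T x k = (if Suc k \<in> switching_times T x then [Suc k] else []) @ switching_after T x (Suc k)"
proof -
  have "[Suc k..<Suc T] = Suc k # [Suc (Suc k)..<Suc T]" using assms by (metis Suc_mono upt_conv_Cons)
  then show ?thesis by (simp add: switching_after_def)
qed

lemma switching_after_nonempty: "k < T \<Longrightarrow> switching_after T x k \<noteq> []"
  unfolding switching_after_def filter_empty_conv by (auto simp: switching_times_def)

lemma sorted_list_of_switching_times:
  assumes "1 \<le> T"
  shows "sorted_list_of_set (switching_times T x) = 0 # switching_after T x 0"
proof (rule sorted_distinct_set_unique)
  have fin: "finite (switching_times T x)" by (simp add: switching_times_def)
  show "set (sorted_list_of_set (switching_times T x)) = set (0 # switching_after T x 0)"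
    unfolding set_sorted_list_of_set[OF fin] switching_after_def
    by (auto simp: switching_times_def)
  show "sorted (0 # switching_after T x 0)"
    unfolding switching_after_def by (simp add: sorted_wrt_filter del: upt_Suc)
  show "distinct (0 # switching_after T x 0)"
    unfolding switching_after_def by (simp del: upt_Suc)
qed auto

text \<open>Induction from the end of the path. At a switching time the current increment is a swing
  of its own, opposite in sign to the next; elsewhere it does not oppose the next swing and is
  merged into it. The claim on signs tells the two cases apart and is therefore proved jointly with
  the others.\<close>

lemma switching_after_properties:
  assumes "k < T" "0 \<le> c"
  shows "sgn (x (hd (switching_after T x k)) - x k) = next_sign T x k \<and>
    (\<forall>s. tv_valid c s \<longrightarrow> fold (tv_step c) (increments (map x (k # switching_after T x k))) s =
        fold (tv_step c) (map (\<lambda>t. x (Suc t) - x t) [k..<T]) s) \<and>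
    (\<forall>up. (if up then 0 \<le> next_sign T x k else next_sign T x k \<le> 0) \<longrightarrow>
        alternating up (increments (map x (k # switching_after T x k))))"
  using assms(1)
proof (induction "T - k" arbitrary: k)
  case (Suc n)
  let ?d = "x (Suc k) - x k"
  have ns: "next_sign T x k = (if ?d \<noteq> 0 then sgn ?d else next_sign T x (Suc k))"
    using Suc.prems by (subst next_sign.simps) simp
  have upt: "[k..<T] = k # [Suc k..<T]" using Suc.prems by (simp add: upt_conv_Cons)
  show ?case
  proof (cases "Suc k = T")
    case True
    have "switching_after T x k = [T]"
      using switching_after_rec[OF Suc.prems, of x] True by (auto simp: switching_times_def switching_after_def)
    moreover have "next_sign T x T = 0" by (subst next_sign.simps) simp
    ultimately show ?thesis using ns True upt by (auto simp: sgn_zero_iff)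
  next
    case False
    then have k: "Suc k < T" using Suc.prems by simp
    note IH = Suc.hyps(1)[of "Suc k", OF _ k]
    have IH1: "sgn (x (hd (switching_after T x (Suc k))) - x (Suc k)) = next_sign T x (Suc k)"
      and IH2: "\<And>s. tv_valid c s \<Longrightarrow> fold (tv_step c) (increments (map x (Suc k # switching_after T x (Suc k)))) s =
        fold (tv_step c) (map (\<lambda>t. x (Suc t) - x t) [Suc k..<T]) s"
      and IH3: "\<And>up. (if up then 0 \<le> next_sign T x (Suc k) else next_sign T x (Suc k) \<le> 0) \<Longrightarrow>
        alternating up (increments (map x (Suc k # switching_after T x (Suc k))))"
      using IH Suc.hyps(2) by (auto simp del: list.map increments.simps)
    have sw: "Suc k \<in> switching_times T x \<longleftrightarrow> ?d \<noteq> 0 \<and> next_sign T x (Suc k) = - sgn ?d"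
      using k by (auto simp: switching_times_def direction_change_iff)
    show ?thesis
    proof (cases "Suc k \<in> switching_times T x")
      case True
      have sa: "switching_after T x k = Suc k # switching_after T x (Suc k)"
        using switching_after_rec[OF Suc.prems, of x] True by simp
      have inc: "increments (map x (k # switching_after T x k)) = ?d # increments (map x (Suc k # switching_after T x (Suc k)))"
        unfolding sa by simp
      have "alternating up (increments (map x (k # switching_after T x k)))"
        if "if up then 0 \<le> next_sign T x k else next_sign T x k \<le> 0" for up
        unfolding inc using IH3[of "\<not> up"] that True sw ns
        by (auto simp: sgn_if split: if_splits)
      moreover have "fold (tv_step c) (increments (map x (k # switching_after T x k))) s =
        fold (tv_step c) (map (\<lambda>t. x (Suc t) - x t) [k..<T]) s" if "tv_valid c s" for s
        unfolding inc upt using IH2[OF tv_step_valid[OF assms(2) that]] by simp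
      moreover have "sgn (x (hd (switching_after T x k)) - x k) = next_sign T x k"
        using True sw ns sa by simp
      ultimately show ?thesis by blast
    next
      case not_sw: False
      have sa: "switching_after T x k = switching_after T x (Suc k)"
        using switching_after_rec[OF Suc.prems, of x] not_sw by simp
      obtain m ms where m: "switching_after T x (Suc k) = m # ms"
        using switching_after_nonempty[OF k] by (cases "switching_after T x (Suc k)") auto
      let ?e = "x m - x (Suc k)"
      have e: "sgn ?e = next_sign T x (Suc k)" using IH1 m by simp
      have inc: "increments (map x (k # switching_after T x k)) = (?d + ?e) # increments (map x (m # ms))"
        unfolding sa m by simp
      have inc': "increments (map x (Suc k # switching_after T x (Suc k))) = ?e # increments (map x (m # ms))"
        unfolding m by simp
      \<comment> \<open>Strictly opposite signs would make \<open>Suc k\<close> a switching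
        time.\<close>
      have same: "0 \<le> ?d \<and> 0 \<le> ?e \<or> ?d \<le> 0 \<and> ?e \<le> 0"
        using not_sw sw e by (auto simp: sgn_if split: if_splits)
      have 1: "sgn (x m - x k) = next_sign T x k"
        using same ns e by (auto simp: sgn_if split: if_splits)
      have "alternating up (increments (map x (k # switching_after T x k)))"
        if up: "if up then 0 \<le> next_sign T x k else next_sign T x k \<le> 0" for up
      proof -
        have "if up then 0 \<le> next_sign T x (Suc k) else next_sign T x (Suc k) \<le> 0"
          using up same ns unfolding e[symmetric] by (auto simp: sgn_if split: if_splits)
        from IH3[OF this] have "alternating (\<not> up) (increments (map x (m # ms)))"
          unfolding inc' by simp
        moreover have "if up then 0 \<le> ?d + ?e else ?d + ?e \<le> 0"
          using up unfolding 1[symmetric] by (auto simp: sgn_if split: if_splits)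
        ultimately show ?thesis unfolding inc by (auto split: if_splits)
      qed
      moreover have "fold (tv_step c) (increments (map x (k # switching_after T x k))) s =
        fold (tv_step c) (map (\<lambda>t. x (Suc t) - x t) [k..<T]) s" if "tv_valid c s" for s
        unfolding upt using IH2[OF tv_step_valid[OF assms(2) that], of ?d]
        unfolding inc inc' by (simp add: tv_step_merge[OF assms(2) that same])
      moreover have "sgn (x (hd (switching_after T x k)) - x k) = next_sign T x k"
        using 1 unfolding sa m by simp
      ultimately show ?thesis by blast
    qed
  qed
qed simp

section \<open>The truncated variation of a path\<close>

primrec tv_state :: "real \<Rightarrow> (nat \<Rightarrow> real) \<Rightarrow> nat \<Rightarrow> real \<times> real \<times> real" where
  "tv_state c x 0 = (- c, - c, 0)"
| "tv_state c x (Suc t) = tv_step c (x (Suc t) - x t) (tv_state c x t)"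

text \<open>The program runs over all unit increments instead of the switching times, so no case
  distinction on the shape of \<open>x\<close> enters.\<close>

definition truncated_variation :: "nat \<Rightarrow> real \<Rightarrow> (nat \<Rightarrow> real) \<Rightarrow> real" where
  "truncated_variation T c x = snd (snd (tv_state c x T))"

lemma tv_state_fold: "tv_state c x T = fold (tv_step c) (map (\<lambda>t. x (Suc t) - x t) [0..<T]) (- c, - c, 0)"
  by (induction T) auto

lemma rainflow_truncated_variation:
  assumes "1 \<le> T" "0 \<le> c"
  shows "(\<Sum>d\<leftarrow>rainflow x (switching_times T x). max 0 (d - c)) = truncated_variation T c x"
proof -
  have "tv_valid c (- c, - c, 0)" using assms by (simp add: tv_valid_def)
  moreover obtain up :: bool where "if up then 0 \<le> next_sign T x 0 else next_sign T x 0 \<le> 0"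
    by (metis linear)
  moreover have "finite (switching_times T x)" by (simp add: switching_times_def)
  moreover have "0 < T" using assms by simp
  ultimately show ?thesis
    using switching_after_properties[of 0 T c x] rainflow_tv[of c "switching_times T x" _ x] assms(2)
    unfolding sorted_list_of_switching_times[OF assms(1)] truncated_variation_def tv_state_fold
    by metis
qed

lemma cycling_cost_rainflow:
  assumes "1 \<le> T"
  shows "cycling_cost T B E a b x = B * E * (\<Sum>d\<leftarrow>rainflow x (switching_times T x). cycle_stress a b d)"
proof -
  let ?S = "switching_times T x" and ?d = "rainflow x (switching_times T x)"
  have "switching_times T x \<subseteq> {0..T}" by (auto simp: switching_times_def)
  then have "card ?S \<le> T + 1" using card_mono[of "{0..T}" ?S] by simp
  then have len: "length ?d \<le> T"
    using length_rainflow[of ?S x] by (simp add: switching_times_def)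
  let ?l = "?d @ replicate (T - length ?d) 0"
  have h: "half_cycle_depths T x = ?l" by (simp add: half_cycle_depths_def Let_def)
  have l: "length ?l = T" using len by simp
  have "(\<Sum>i = 1..T. cycle_stress a b (?l ! (i - 1))) = (\<Sum>i<T. cycle_stress a b (?l ! i))"
    by (rule sum.reindex_bij_witness[of _ Suc "\<lambda>i. i - 1"]) auto
  also have "\<dots> = sum_list (map (cycle_stress a b) ?l)"
    unfolding sum_list_sum_nth length_map l atLeast0LessThan
    by (rule sum.cong) (use l in \<open>auto simp del: map_append\<close>)
  \<comment> \<open>The padding costs nothing, as \<open>0 powr b\<close> is 0.\<close>
  also have "\<dots> = sum_list (map (cycle_stress a b) ?d)"
    by (simp add: cycle_stress_def sum_list_replicate)
  finally show ?thesis unfolding cycling_cost_def h by simp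
qed

section \<open>Convexity of the cycling cost\<close>

lemma convex_combination_max:
  fixes a b a' b' t :: real
  assumes "0 \<le> t" "t \<le> 1" "p \<le> (1 - t) * a + t * a'" "q \<le> (1 - t) * b + t * b'"
  shows "max p q \<le> (1 - t) * max a b + t * max a' b'"
proof -
  have "(1 - t) * a \<le> (1 - t) * max a b" "(1 - t) * b \<le> (1 - t) * max a b"
    "t * a' \<le> t * max a' b'" "t * b' \<le> t * max a' b'"
    using assms by (auto intro!: mult_left_mono)
  then show ?thesis using assms(3,4) by linarith
qed

text \<open>Each new component is a maximum of expressions that are increasing in the old components
  and affine in the increment. The hypotheses are inequalities, of the same form as the conclusion,
  so that the step can be iterated.\<close>

lemma tv_step_convex:
  fixes t :: real
  assumes t: "0 \<le> t" "t \<le> 1" and d: "d = (1 - t) * a + t * b"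
    and "U \<le> (1 - t) * U1 + t * U2" "L \<le> (1 - t) * L1 + t * L2" "N \<le> (1 - t) * N1 + t * N2"
    and "tv_step c d (U, L, N) = (U', L', N')"
    and "tv_step c a (U1, L1, N1) = (U1', L1', N1')"
    and "tv_step c b (U2, L2, N2) = (U2', L2', N2')"
  shows "U' \<le> (1 - t) * U1' + t * U2' \<and> L' \<le> (1 - t) * L1' + t * L2' \<and> N' \<le> (1 - t) * N1' + t * N2'"
proof -
  have eqs: "N' = max N (max (U + d) (L - d))" "U' = max (U + d) (N' - c)" "L' = max (L - d) (N' - c)"
    "N1' = max N1 (max (U1 + a) (L1 - a))" "U1' = max (U1 + a) (N1' - c)" "L1' = max (L1 - a) (N1' - c)"
    "N2' = max N2 (max (U2 + b) (L2 - b))" "U2' = max (U2 + b) (N2' - c)" "L2' = max (L2 - b) (N2' - c)"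
    using assms(7-9) by (auto simp: tv_step_def Let_def)
  have u: "U + d \<le> (1 - t) * (U1 + a) + t * (U2 + b)" and l: "L - d \<le> (1 - t) * (L1 - a) + t * (L2 - b)"
    using assms(4,5) d by (auto simp: algebra_simps)
  have n: "N' \<le> (1 - t) * N1' + t * N2'"
    unfolding eqs by (intro convex_combination_max t assms(6) u l)
  then have n': "N' - c \<le> (1 - t) * (N1' - c) + t * (N2' - c)" by (simp add: algebra_simps)
  show ?thesis
    using n convex_combination_max[OF t u n'] convex_combination_max[OF t l n'] eqs(2,3,5,6,8,9) by simp
qed

lemma truncated_variation_convex:
  assumes t: "0 \<le> t" "t \<le> 1" and z: "\<And>i. i \<le> T \<Longrightarrow> z i = (1 - t) * x i + t * y i"
  shows "truncated_variation T c z \<le> (1 - t) * truncated_variation T c x + t * truncated_variation T c y"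
proof -
  have "i \<le> T \<Longrightarrow> tv_state c z i = (U, L, N) \<Longrightarrow> tv_state c x i = (U1, L1, N1) \<Longrightarrow>
    tv_state c y i = (U2, L2, N2) \<Longrightarrow>
    U \<le> (1 - t) * U1 + t * U2 \<and> L \<le> (1 - t) * L1 + t * L2 \<and> N \<le> (1 - t) * N1 + t * N2"
    for i U L N U1 L1 N1 U2 L2 N2
  proof (induction i arbitrary: U L N U1 L1 N1 U2 L2 N2)
    case 0
    then show ?case by (auto simp: algebra_simps)
  next
    case (Suc i)
    obtain U' L' N' U1' L1' N1' U2' L2' N2' where
      s: "tv_state c z i = (U', L', N')" "tv_state c x i = (U1', L1', N1')" "tv_state c y i = (U2', L2', N2')"
      by (metis prod_cases3)
    have "z (Suc i) - z i = (1 - t) * (x (Suc i) - x i) + t * (y (Suc i) - y i)"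
      using z Suc.prems(1) by (simp add: algebra_simps)
    note d = this
    have "i \<le> T" using Suc.prems(1) by simp
    note ih = Suc.IH[OF this s]
    note steps = Suc.prems(2-4)[unfolded tv_state.simps s]
    show ?case
      using tv_step_convex[OF t d conjunct1[OF ih] conjunct1[OF conjunct2[OF ih]] conjunct2[OF conjunct2[OF ih]] steps] .
  qed
  from this[of T] show ?thesis
    unfolding truncated_variation_def
    by (cases "tv_state c x T"; cases "tv_state c y T"; cases "tv_state c z T") auto
qed

lemma tv_step_lipschitz:
  assumes "\<bar>U1 - U2\<bar> \<le> k" "\<bar>L1 - L2\<bar> \<le> k" "\<bar>N1 - N2\<bar> \<le> k" "\<bar>a - b\<bar> \<le> e"
    and "tv_step c a (U1, L1, N1) = (U1', L1', N1')"
    and "tv_step c b (U2, L2, N2) = (U2', L2', N2')"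
  shows "\<bar>U1' - U2'\<bar> \<le> k + e \<and> \<bar>L1' - L2'\<bar> \<le> k + e \<and> \<bar>N1' - N2'\<bar> \<le> k + e"
proof -
  have m: "\<bar>max p q - max p' q'\<bar> \<le> r" if "\<bar>p - p'\<bar> \<le> r" "\<bar>q - q'\<bar> \<le> r" for p q p' q' r :: real
    using that by linarith
  have eqs: "N1' = max N1 (max (U1 + a) (L1 - a))" "U1' = max (U1 + a) (N1' - c)" "L1' = max (L1 - a) (N1' - c)"
    "N2' = max N2 (max (U2 + b) (L2 - b))" "U2' = max (U2 + b) (N2' - c)" "L2' = max (L2 - b) (N2' - c)"
    using assms(5,6) by (auto simp: tv_step_def Let_def)
  have u: "\<bar>(U1 + a) - (U2 + b)\<bar> \<le> k + e" and l: "\<bar>(L1 - a) - (L2 - b)\<bar> \<le> k + e"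
    and n: "\<bar>N1 - N2\<bar> \<le> k + e"
    using assms by linarith+
  have n: "\<bar>N1' - N2'\<bar> \<le> k + e" unfolding eqs by (intro m u l n)
  then have n': "\<bar>(N1' - c) - (N2' - c)\<bar> \<le> k + e" by simp
  show ?thesis using n m[OF u n'] m[OF l n'] eqs(2,3,5,6) by simp
qed

text \<open>Maxima are nonexpansive, so each of the \<open>T\<close> steps adds at most the change
  \<open>2 * e\<close> of its increment. The bound does not depend on \<open>c\<close>, hence
  survives weighted sums over levels.\<close>

lemma truncated_variation_lipschitz:
  assumes "\<And>i. i \<le> T \<Longrightarrow> \<bar>x i - y i\<bar> \<le> e"
  shows "\<bar>truncated_variation T c x - truncated_variation T c y\<bar> \<le> 2 * real T * e"
proof -
  have "i \<le> T \<Longrightarrow> tv_state c x i = (U1, L1, N1) \<Longrightarrow> tv_state c y i = (U2, L2, N2) \<Longrightarrow>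
    \<bar>U1 - U2\<bar> \<le> 2 * real i * e \<and> \<bar>L1 - L2\<bar> \<le> 2 * real i * e \<and> \<bar>N1 - N2\<bar> \<le> 2 * real i * e"
    for i U1 L1 N1 U2 L2 N2
  proof (induction i arbitrary: U1 L1 N1 U2 L2 N2)
    case (Suc i)
    obtain U1' L1' N1' U2' L2' N2' where
      s: "tv_state c x i = (U1', L1', N1')" "tv_state c y i = (U2', L2', N2')"
      by (metis prod_cases3)
    have "\<bar>(x (Suc i) - x i) - (y (Suc i) - y i)\<bar> \<le> 2 * e"
      using assms[of i] assms[of "Suc i"] Suc.prems(1) by linarith
    note d = this
    have "i \<le> T" using Suc.prems(1) by simp
    note ih = Suc.IH[OF this s]
    note steps = Suc.prems(2,3)[unfolded tv_state.simps s]
    have "\<bar>U1 - U2\<bar> \<le> 2 * real i * e + 2 * e \<and> \<bar>L1 - L2\<bar> \<le> 2 * real i * e + 2 * e \<and>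
        \<bar>N1 - N2\<bar> \<le> 2 * real i * e + 2 * e"
      using tv_step_lipschitz[OF conjunct1[OF ih] conjunct1[OF conjunct2[OF ih]] conjunct2[OF conjunct2[OF ih]] d steps] .
    then show ?case by (simp add: algebra_simps)
  qed auto
  from this[of T] show ?thesis
    unfolding truncated_variation_def
    by (cases "tv_state c x T"; cases "tv_state c y T") auto
qed

section \<open>Convex functions as nonnegative sums of hinges\<close>

text \<open>
  The condition \<open>w (Max A) = 0\<close> leaves room for one more node; the bound beyond \<open>Max A\<close> makes
  the weight added there nonnegative.
\<close>

lemma hinge_interpolation:
  fixes f :: "real \<Rightarrow> real"
  assumes "convex_on {0..} f" "f 0 = 0" "\<And>s. 0 \<le> s \<Longrightarrow> 0 \<le> f s" "finite A" "A \<subseteq> {0..}" "0 \<in> A"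
  shows "\<exists>w. (\<forall>a\<in>A. 0 \<le> w a) \<and> (\<forall>s\<in>A. f s = (\<Sum>a\<in>A. w a * max 0 (s - a))) \<and>
    (\<forall>s\<ge>Max A. (\<Sum>a\<in>A. w a * max 0 (s - a)) \<le> f s) \<and> w (Max A) = 0"
proof -
  \<comment> \<open>The node 0 is kept apart, so every stage of the induction has a largest node;
    the positive nodes are added in increasing order.\<close>
  have "\<exists>w. (\<forall>a\<in>insert 0 A. 0 \<le> w a) \<and> (\<forall>s\<in>insert 0 A. f s = (\<Sum>a\<in>insert 0 A. w a * max 0 (s - a))) \<and>
    (\<forall>s\<ge>Max (insert 0 A). (\<Sum>a\<in>insert 0 A. w a * max 0 (s - a)) \<le> f s) \<and> w (Max (insert 0 A)) = 0"
    if "finite A" "A \<subseteq> {0<..}" for A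
    using that
  proof (induction A rule: finite_linorder_max_induct)
    case empty
    show ?case using assms(2,3) by (intro exI[of _ "\<lambda>_. 0"]) auto
  next
    case (insert b A)
    let ?A = "insert 0 A"
    define m where "m = Max ?A"
    have b: "0 < b" and bA: "\<forall>a\<in>?A. a < b" and fin: "finite ?A" using insert by auto
    have m: "m \<in> ?A" "\<forall>a\<in>?A. a \<le> m" unfolding m_def using fin Max_in[OF fin] by auto
    have m0: "0 \<le> m" "m < b" using m bA by auto
    from insert obtain w where w: "\<forall>a\<in>?A. 0 \<le> w a"
      and eq: "\<forall>s\<in>?A. f s = (\<Sum>a\<in>?A. w a * max 0 (s - a))"
      and le: "\<forall>s\<ge>m. (\<Sum>a\<in>?A. w a * max 0 (s - a)) \<le> f s" and wm: "w m = 0"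
      unfolding m_def by auto
    let ?L = "\<lambda>s. \<Sum>a\<in>?A. w a * max 0 (s - a)"
    \<comment> \<open>The additional slope from \<open>m\<close> onwards that makes the interpolant
      meet \<open>f\<close> at \<open>b\<close>.\<close>
    define k where "k = (f b - ?L b) / (b - m)"
    define w' where "w' = w(m := k, b := 0)"
    have k: "0 \<le> k" unfolding k_def using le m0 by simp
    have bn: "b \<notin> ?A" using bA by auto
    have L': "(\<Sum>a\<in>insert b ?A. w' a * max 0 (s - a)) = ?L s + k * max 0 (s - m)" for s
    proof -
      have "(\<Sum>a\<in>insert b ?A. w' a * max 0 (s - a)) = (\<Sum>a\<in>?A. w' a * max 0 (s - a))"
        using fin bn by (simp add: w'_def)
      also have "\<dots> = w' m * max 0 (s - m) + (\<Sum>a\<in>?A - {m}. w' a * max 0 (s - a))"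
        using fin m(1) by (rule sum.remove)
      also have "(\<Sum>a\<in>?A - {m}. w' a * max 0 (s - a)) = (\<Sum>a\<in>?A - {m}. w a * max 0 (s - a))"
        using bn by (intro sum.cong) (auto simp: w'_def)
      also have "\<dots> = ?L s"
        using sum.remove[OF fin m(1), of "\<lambda>a. w a * max 0 (s - a)"] wm by simp
      finally show ?thesis using m0 by (simp add: w'_def)
    qed
    have aff: "?L s = (\<Sum>a\<in>?A. w a) * s - (\<Sum>a\<in>?A. w a * a)" if "m \<le> s" for s
    proof -
      have "?L s = (\<Sum>a\<in>?A. w a * s - w a * a)"
        using m(2) that by (intro sum.cong) (auto simp: right_diff_distrib)
      then show ?thesis by (simp add: sum_subtractf sum_distrib_right)
    qed
    have fm: "f m = ?L m" using eq m(1) by blast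
    have fb: "f b = ?L b + k * (b - m)" using m0 by (simp add: k_def)
    have Max': "Max (insert b ?A) = b"
      using fin bA by (intro Max_eqI) (auto intro: less_imp_le)
    have "?L s + k * max 0 (s - m) \<le> f s" if "b \<le> s" for s
    proof (cases "s = b")
      case True
      then show ?thesis using fb m0 by simp
    next
      case False
      \<comment> \<open>Writes \<open>b\<close> as a convex combination of \<open>m\<close> and
        \<open>s\<close>: by convexity, \<open>f s\<close> lies above the line through the values at
        \<open>m\<close> and \<open>b\<close>, which is the new interpolant.\<close>
      define u where "u = (b - m) / (s - m)"
      have u: "0 < u" "u \<le> 1" and "u * (s - m) = b - m"
        using m0 that by (auto simp: u_def)
      then have bu: "b = (1 - u) * m + u * s" by (simp add: algebra_simps)
      have "f b \<le> (1 - u) * f m + u * f s"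
        using convex_onD[OF assms(1), of u m s] u m0 that bu by simp
      moreover have "f b = (1 - u) * f m + u * (?L s + k * (s - m))"
      proof -
        define p q where "p = sum w ?A" and "q = (\<Sum>a\<in>?A. w a * a)"
        have "?L b = p * b - q" "?L m = p * m - q" "?L s = p * s - q"
          unfolding p_def q_def using m0 that by (intro aff; simp)+
        then show ?thesis
          using arg_cong[OF bu, of "(*) p"] arg_cong[OF bu, of "(*) k"] unfolding fm fb
          by (simp only:) (simp add: algebra_simps)
      qed
      ultimately have "u * (?L s + k * (s - m)) \<le> u * f s" by linarith
      then show ?thesis using u m0 that by simp
    qed
    moreover have "f s = ?L s + k * max 0 (s - m)" if "s \<in> insert b ?A" for s
      using that eq m(2) fb m0 by (auto simp: max_def)
    moreover have "0 \<le> w' a" if "a \<in> insert b ?A" for a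
      using that w k by (auto simp: w'_def)
    ultimately have "(\<forall>a\<in>insert b ?A. 0 \<le> w' a) \<and>
      (\<forall>s\<in>insert b ?A. f s = (\<Sum>a\<in>insert b ?A. w' a * max 0 (s - a))) \<and>
      (\<forall>s\<ge>Max (insert b ?A). (\<Sum>a\<in>insert b ?A. w' a * max 0 (s - a)) \<le> f s) \<and>
      w' (Max (insert b ?A)) = 0"
      unfolding L' Max' by (simp add: w'_def)
    then show ?case by (subst (1 2 3 4 5 6) insert_commute) blast
  qed
  from this[of "A - {0}"] show ?thesis
    using assms(4-6) by (simp add: insert_absorb) (use assms(5) in force)
qed

section \<open>The cycling cost as a weighted sum of truncated variations\<close>

lemma cycle_stress_convex:
  assumes "0 < a" "1 < b"
  shows "convex_on {0..} (cycle_stress a b)"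
proof (rule convex_on_linorderI)
  fix t x y :: real
  assume t: "0 < t" "t < 1" and xy: "x \<in> {0..}" "y \<in> {0..}" "x < y"
  have "((1 - t) * x + t * y) powr b \<le> (1 - t) * x powr b + t * y powr b"
  proof (cases "x = 0")
    case True
    have "t powr b \<le> t" using powr_mono'[of 1 b t] t assms by simp
    then have "t powr b * y powr b \<le> t * y powr b" by (intro mult_right_mono) auto
    then show ?thesis using True t xy assms by (simp add: powr_mult)
  next
    case False
    then show ?thesis
      using convex_onD[OF powr_convex[of b], of t x y] t xy assms by simp
  qed
  then have "a / 2 * ((1 - t) * x + t * y) powr b \<le> a / 2 * ((1 - t) * x powr b + t * y powr b)"
    using assms by (intro mult_left_mono) auto
  moreover have "a / 2 * ((1 - t) * x powr b + t * y powr b) =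
      (1 - t) * (a / 2 * x powr b) + t * (a / 2 * y powr b)"
    by (simp add: distrib_left mult.left_commute)
  ultimately show "cycle_stress a b ((1 - t) *\<^sub>R x + t *\<^sub>R y) \<le> (1 - t) * cycle_stress a b x + t * cycle_stress a b y"
    unfolding cycle_stress_def by simp
qed simp

text \<open>To compare several paths the weights must be common to them, so the nodes collect the
  depths of all paths in \<open>X\<close>. The bound on the total weight is the same for every
  \<open>X\<close>, which makes the Lipschitz constant of the cost uniform.\<close>

lemma cycling_cost_hinges:
  assumes "1 \<le> T" "0 < a" "1 < b" "finite X"
    and X: "\<forall>x\<in>X. \<forall>t\<le>T. 0 \<le> x t \<and> x t \<le> 1"
  obtains C w where "finite C" "\<And>c. c \<in> C \<Longrightarrow> 0 \<le> w c" "sum w C \<le> cycle_stress a b 2"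
    "\<And>x. x \<in> X \<Longrightarrow> cycling_cost T B E a b x = B * E * (\<Sum>c\<in>C. w c * truncated_variation T c x)"
proof -
  let ?d = "\<lambda>x. rainflow x (switching_times T x)"
  \<comment> \<open>All depths are at most 1, so the extra node 2 bounds the total weight by the stress at 2.\<close>
  define C where "C = {0, 2} \<union> (\<Union>x\<in>X. set (?d x))"
  have fin: "finite C" using assms(4) by (auto simp: C_def)
  have depth: "0 \<le> d \<and> d \<le> 1" if "x \<in> X" "d \<in> set (?d x)" for x d
  proof -
    have "finite (switching_times T x)" by (simp add: switching_times_def)
    from rainflow_depth[OF this that(2)] obtain p q
      where "p \<in> switching_times T x" "q \<in> switching_times T x" and d: "d = \<bar>x p - x q\<bar>" by blast
    then have "p \<le> T" "q \<le> T" by (auto simp: switching_times_def)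
    then have "0 \<le> x p \<and> x p \<le> 1" "0 \<le> x q \<and> x q \<le> 1" using X that(1) by blast+
    then show ?thesis using d by auto
  qed
  have C: "0 \<le> c" "c \<le> 1 \<or> c = 2" if "c \<in> C" for c
    using that depth by (auto simp: C_def)
  have "Max C = 2"
    using fin C by (intro Max_eqI) (force simp: C_def)+
  moreover have "C \<subseteq> {0..}" "0 \<in> C" using C by (auto simp: C_def)
  moreover have "cycle_stress a b 0 = 0" "\<And>s. 0 \<le> cycle_stress a b s"
    using assms by (auto simp: cycle_stress_def)
  ultimately have "\<exists>w. (\<forall>c\<in>C. 0 \<le> w c) \<and> (\<forall>s\<in>C. cycle_stress a b s = (\<Sum>c\<in>C. w c * max 0 (s - c))) \<and>
      (\<forall>s\<ge>2. (\<Sum>c\<in>C. w c * max 0 (s - c)) \<le> cycle_stress a b s) \<and> w 2 = 0"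
    using hinge_interpolation[OF cycle_stress_convex[OF assms(2,3)] _ _ fin] by metis
  then obtain w where w: "\<And>c. c \<in> C \<Longrightarrow> 0 \<le> w c" "w 2 = 0"
    and eq: "\<And>s. s \<in> C \<Longrightarrow> cycle_stress a b s = (\<Sum>c\<in>C. w c * max 0 (s - c))"
    by blast
  \<comment> \<open>At \<open>s = 2\<close> every hinge with a node in the unit interval is at least
    1, and the node 2 itself has weight 0.\<close>
  have "sum w C \<le> (\<Sum>c\<in>C. w c * max 0 (2 - c))"
  proof (rule sum_mono)
    fix c assume c: "c \<in> C"
    show "w c \<le> w c * max 0 (2 - c)"
    proof (cases "c = 2")
      case False
      then have "w c * 1 \<le> w c * max 0 (2 - c)" using C[OF c] w(1)[OF c] by (intro mult_left_mono) auto
      then show ?thesis by simp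
    qed (simp add: w)
  qed
  also have "\<dots> = cycle_stress a b 2" by (rule eq[symmetric]) (simp add: C_def)
  finally have "sum w C \<le> cycle_stress a b 2" .
  moreover have "cycling_cost T B E a b x = B * E * (\<Sum>c\<in>C. w c * truncated_variation T c x)" if x: "x \<in> X" for x
  proof -
    have swap: "(\<Sum>d\<leftarrow>ds. \<Sum>c\<in>C. w c * max 0 (d - c)) = (\<Sum>c\<in>C. w c * (\<Sum>d\<leftarrow>ds. max 0 (d - c)))" for ds
      by (induction ds) (auto simp: sum.distrib distrib_left)
    have "(\<Sum>d\<leftarrow>?d x. cycle_stress a b d) = (\<Sum>d\<leftarrow>?d x. \<Sum>c\<in>C. w c * max 0 (d - c))"
      using x by (intro arg_cong[of _ _ sum_list] map_cong refl eq) (auto simp: C_def)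
    also have "\<dots> = (\<Sum>c\<in>C. w c * truncated_variation T c x)"
      unfolding swap using C(1) by (intro sum.cong) (auto simp: rainflow_truncated_variation[OF assms(1)])
    finally show ?thesis unfolding cycling_cost_rainflow[OF assms(1)] by simp
  qed
  ultimately show thesis using that fin w(1) by blast
qed

lemma cycling_cost_convex:
  assumes "1 \<le> T" "0 < a" "1 < b" "0 < B" "0 < E"
    and x: "\<And>i. i \<le> T \<Longrightarrow> 0 \<le> x i \<and> x i \<le> 1" and y: "\<And>i. i \<le> T \<Longrightarrow> 0 \<le> y i \<and> y i \<le> 1"
    and t: "0 \<le> t" "t \<le> 1"
  shows "cycling_cost T B E a b (\<lambda>i. (1 - t) * x i + t * y i) \<le>
    (1 - t) * cycling_cost T B E a b x + t * cycling_cost T B E a b y"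
proof -
  define z where "z = (\<lambda>i. (1 - t) * x i + t * y i)"
  have z: "0 \<le> z i \<and> z i \<le> 1" if "i \<le> T" for i
    using x[OF that] y[OF that] t convex_bound_le[of "x i" 1 "y i" "1 - t" t] by (simp add: z_def)
  have fin: "finite {x, y, z}" by simp
  have X: "\<forall>v\<in>{x, y, z}. \<forall>i\<le>T. 0 \<le> v i \<and> v i \<le> 1"
    using x y z by blast
  obtain C w where "finite C" and w: "\<And>c. c \<in> C \<Longrightarrow> 0 \<le> w c" "sum w C \<le> cycle_stress a b 2"
    and cc: "\<And>v. v \<in> {x, y, z} \<Longrightarrow> cycling_cost T B E a b v = B * E * (\<Sum>c\<in>C. w c * truncated_variation T c v)"
    using cycling_cost_hinges[where X = "{x, y, z}" and B = B and E = E, OF assms(1-3) fin X] by blast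
  have "(\<Sum>c\<in>C. w c * truncated_variation T c z) \<le>
      (\<Sum>c\<in>C. w c * ((1 - t) * truncated_variation T c x + t * truncated_variation T c y))"
    using w(1) t by (intro sum_mono mult_left_mono truncated_variation_convex) (auto simp: z_def)
  also have "\<dots> = (1 - t) * (\<Sum>c\<in>C. w c * truncated_variation T c x) + t * (\<Sum>c\<in>C. w c * truncated_variation T c y)"
    by (simp add: sum.distrib sum_distrib_left distrib_left mult.left_commute)
  finally have "B * E * (\<Sum>c\<in>C. w c * truncated_variation T c z) \<le>
      B * E * ((1 - t) * (\<Sum>c\<in>C. w c * truncated_variation T c x) + t * (\<Sum>c\<in>C. w c * truncated_variation T c y))"
    using assms(4,5) by (intro mult_left_mono) auto
  then show ?thesis unfolding z_def[symmetric] by (simp add: cc algebra_simps)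
qed

lemma cycling_cost_lipschitz:
  assumes "1 \<le> T" "0 < a" "1 < b" "0 < B" "0 < E"
    and x: "\<And>i. i \<le> T \<Longrightarrow> 0 \<le> x i \<and> x i \<le> 1" and y: "\<And>i. i \<le> T \<Longrightarrow> 0 \<le> y i \<and> y i \<le> 1"
    and e: "\<And>i. i \<le> T \<Longrightarrow> \<bar>x i - y i\<bar> \<le> e"
  shows "\<bar>cycling_cost T B E a b x - cycling_cost T B E a b y\<bar> \<le> B * E * (cycle_stress a b 2 * (2 * real T * e))"
proof -
  have fin: "finite {x, y}" by simp
  have X: "\<forall>v\<in>{x, y}. \<forall>i\<le>T. 0 \<le> v i \<and> v i \<le> 1"
    using x y by blast
  obtain C w where "finite C" and w: "\<And>c. c \<in> C \<Longrightarrow> 0 \<le> w c" "sum w C \<le> cycle_stress a b 2"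
    and cc: "\<And>v. v \<in> {x, y} \<Longrightarrow> cycling_cost T B E a b v = B * E * (\<Sum>c\<in>C. w c * truncated_variation T c v)"
    using cycling_cost_hinges[where X = "{x, y}" and B = B and E = E, OF assms(1-3) fin X] by blast
  have "0 \<le> e" using e[of 0] by linarith
  have "\<bar>(\<Sum>c\<in>C. w c * truncated_variation T c x) - (\<Sum>c\<in>C. w c * truncated_variation T c y)\<bar> =
      \<bar>\<Sum>c\<in>C. w c * (truncated_variation T c x - truncated_variation T c y)\<bar>"
    by (simp add: sum_subtractf right_diff_distrib)
  also have "\<dots> \<le> (\<Sum>c\<in>C. \<bar>w c * (truncated_variation T c x - truncated_variation T c y)\<bar>)"
    by (rule sum_abs)
  also have "\<dots> \<le> (\<Sum>c\<in>C. w c * (2 * real T * e))"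
    using w(1) by (intro sum_mono) (auto simp: abs_mult intro!: mult_left_mono truncated_variation_lipschitz e)
  also have "\<dots> = sum w C * (2 * real T * e)" by (simp add: sum_distrib_right)
  also have "\<dots> \<le> cycle_stress a b 2 * (2 * real T * e)"
    using w(2) \<open>0 \<le> e\<close> by (intro mult_right_mono) auto
  finally have "B * E * \<bar>(\<Sum>c\<in>C. w c * truncated_variation T c x) - (\<Sum>c\<in>C. w c * truncated_variation T c y)\<bar>
      \<le> B * E * (cycle_stress a b 2 * (2 * real T * e))"
    using assms(4,5) by (intro mult_left_mono) auto
  moreover have "cycling_cost T B E a b x - cycling_cost T B E a b y =
      B * E * ((\<Sum>c\<in>C. w c * truncated_variation T c x) - (\<Sum>c\<in>C. w c * truncated_variation T c y))"
    by (simp add: cc right_diff_distrib)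
  ultimately show ?thesis using assms(4,5) by (simp add: abs_mult)
qed

section \<open>Duality\<close>

text \<open>Compactness is stated by coordinates because vectors are functions on all of
  \<open>nat\<close> whose irrelevant entries are unrestricted.\<close>

lemma bounded_coordinates_subsequence:
  fixes X :: "nat \<Rightarrow> 'i \<Rightarrow> real"
  assumes "finite I" "\<And>n i. i \<in> I \<Longrightarrow> \<bar>X n i\<bar> \<le> M i"
  shows "\<exists>r L. strict_mono (r :: nat \<Rightarrow> nat) \<and> (\<forall>i\<in>I. (\<lambda>n. X (r n) i) \<longlonglongrightarrow> L i)"
  using assms
proof (induction I rule: finite_induct)
  case empty
  show ?case by (intro exI[of _ id]) (auto simp: strict_mono_def)
next
  case (insert j I)
  then obtain r L where r: "strict_mono r" and L: "\<And>i. i \<in> I \<Longrightarrow> (\<lambda>n. X (r n) i) \<longlonglongrightarrow> L i"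
    by (metis insertCI)
  obtain s where s: "strict_mono s" "monoseq (\<lambda>n. X (r (s n)) j)"
    using seq_monosub[of "\<lambda>n. X (r n) j"] by blast
  have "Bseq (\<lambda>n. X (r (s n)) j)"
    using insert.prems[of j] by (intro BseqI'[of _ "M j"]) auto
  then obtain l where l: "(\<lambda>n. X (r (s n)) j) \<longlonglongrightarrow> l"
    using s(2) Bseq_monoseq_convergent convergent_def by blast
  have "(\<lambda>n. X ((r \<circ> s) n) i) \<longlonglongrightarrow> (L(j := l)) i" if "i \<in> insert j I" for i
    using that l LIMSEQ_subseq_LIMSEQ[OF L s(1), of i] by (auto simp: o_def)
  then show ?case using strict_mono_o[OF r s(1)] by blast
qed

text \<open>
  The multiplier is \<open>k * h z\<close> for an approximate minimizer \<open>z\<close> of the penalized objective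
  \<open>f + k / 2 * (\<Sum>i\<in>I. (h _ i)\<^sup>2)\<close>, by the first-order condition along segments from \<open>z\<close>.
\<close>

lemma approximate_multiplier:
  fixes f :: "'a \<Rightarrow> real" and h :: "'a \<Rightarrow> 'i \<Rightarrow> real"
  assumes "finite I"
    and mix: "\<And>z z' t. z \<in> K \<Longrightarrow> z' \<in> K \<Longrightarrow> 0 \<le> t \<Longrightarrow> t \<le> 1 \<Longrightarrow>
      \<exists>w\<in>K. f w \<le> (1 - t) * f z + t * f z' \<and> (\<forall>i\<in>I. h w i = (1 - t) * h z i + t * h z' i)"
    and m: "\<And>z. z \<in> K \<Longrightarrow> m \<le> f z"
    and M: "\<And>z i. z \<in> K \<Longrightarrow> i \<in> I \<Longrightarrow> \<bar>h z i\<bar> \<le> M i"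
    and z0: "z\<^sub>0 \<in> K" "\<And>i. i \<in> I \<Longrightarrow> h z\<^sub>0 i = 0"
    and "0 < \<epsilon>" "0 < \<eta>"
    and lsc: "\<And>z. z \<in> K \<Longrightarrow> \<forall>i\<in>I. \<bar>h z i\<bar> \<le> \<eta> \<Longrightarrow> f z\<^sub>0 - \<epsilon> \<le> f z"
  shows "\<exists>l. \<forall>z\<in>K. f z\<^sub>0 - 2 * \<epsilon> \<le> f z + (\<Sum>i\<in>I. l i * h z i)"
proof -
  let ?v = "f z\<^sub>0"
  \<comment> \<open>Chosen so that \<open>k / 2 * q z \<le> f z\<^sub>0 - m + 1\<close>, which holds
    for approximate minimizers, amounts to \<open>q z \<le> \<eta>\<^sup>2\<close>.\<close>
  define k where "k = 2 * (?v - m + 1) / \<eta>\<^sup>2"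
  define Q where "Q = (\<Sum>i\<in>I. (2 * M i)\<^sup>2)"
  define q where "q z = (\<Sum>i\<in>I. (h z i)\<^sup>2)" for z
  define \<phi> where "\<phi> z = f z + k / 2 * q z" for z
  \<comment> \<open>Length of the step along the segment. Minimality up to \<open>t\<^sup>2\<close>
    costs \<open>t\<close> after division by \<open>t\<close>, and the quadratic term costs at most
    \<open>t * (k / 2 * Q)\<close>; together they stay below \<open>\<epsilon>\<close>.\<close>
  define t where "t = min 1 (\<epsilon> / (1 + k / 2 * Q))"
  have vm: "0 < ?v - m + 1" using m[OF z0(1)] by simp
  then have k: "0 < k" using \<open>0 < \<eta>\<close> by (simp add: k_def)
  have Q: "0 \<le> Q" unfolding Q_def by (intro sum_nonneg) auto
  have q: "0 \<le> q z" for z unfolding q_def by (intro sum_nonneg) auto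
  have pos: "0 < 1 + k / 2 * Q" using k Q by (simp add: add_pos_nonneg)
  then have t: "0 < t" "t \<le> 1" using \<open>0 < \<epsilon>\<close> by (auto simp: t_def)
  have tQ: "t * (1 + k / 2 * Q) \<le> \<epsilon>"
    unfolding pos_le_divide_eq[OF pos, symmetric] by (simp add: t_def)
  have bdd: "bdd_below (\<phi> ` K)"
    using m q k by (intro bdd_belowI2[of _ m]) (auto simp: \<phi>_def intro!: add_increasing2)
  have "Inf (\<phi> ` K) < Inf (\<phi> ` K) + t\<^sup>2" using t by simp
  then obtain z where z: "z \<in> K" "\<phi> z < Inf (\<phi> ` K) + t\<^sup>2"
    using cInf_lessD[of "\<phi> ` K"] z0(1) by blast
  have near: "\<phi> z \<le> \<phi> w + t\<^sup>2" if "w \<in> K" for w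
    using cInf_lower[OF _ bdd, of "\<phi> w"] that z(2) by simp
  have "\<phi> z\<^sub>0 = ?v" using z0(2) by (simp add: \<phi>_def q_def)
  moreover have "t\<^sup>2 \<le> 1" using t by (simp add: power_le_one)
  ultimately have "k / 2 * q z \<le> ?v - m + 1"
    using near[OF z0(1)] m[OF z(1)] unfolding \<phi>_def by linarith
  then have "(?v - m + 1) * q z \<le> (?v - m + 1) * \<eta>\<^sup>2"
    using \<open>0 < \<eta>\<close> by (simp add: k_def field_simps)
  then have qz: "q z \<le> \<eta>\<^sup>2" using vm by simp
  have "\<bar>h z i\<bar> \<le> \<eta>" if "i \<in> I" for i
  proof -
    have "(h z i)\<^sup>2 \<le> q z"
      unfolding q_def using assms(1) that by (intro member_le_sum) auto
    then show ?thesis using qz \<open>0 < \<eta>\<close> by (metis abs_le_square_iff abs_of_pos order_trans)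
  qed
  then have fz: "?v - \<epsilon> \<le> f z" using lsc[OF z(1)] by blast
  have "?v - 2 * \<epsilon> \<le> f z' + (\<Sum>i\<in>I. k * h z i * h z' i)" if z': "z' \<in> K" for z'
  proof -
    obtain w where w: "w \<in> K" "f w \<le> (1 - t) * f z + t * f z'"
      "\<And>i. i \<in> I \<Longrightarrow> h w i = (1 - t) * h z i + t * h z' i"
      using mix[OF z(1) z', of t] t by auto
    let ?c = "\<Sum>i\<in>I. h z i * h z' i" and ?r = "\<Sum>i\<in>I. (h z' i - h z i)\<^sup>2"
    have "q w = (\<Sum>i\<in>I. (h z i)\<^sup>2 + 2 * t * (h z i * h z' i - (h z i)\<^sup>2) + t\<^sup>2 * (h z' i - h z i)\<^sup>2)"
      unfolding q_def by (rule sum.cong) (auto simp: w(3) power2_eq_square algebra_simps)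
    also have "\<dots> = q z + 2 * t * (?c - q z) + t\<^sup>2 * ?r"
      by (simp add: q_def sum.distrib sum_distrib_left flip: sum_subtractf)
    finally have qw: "q w = q z + 2 * t * (?c - q z) + t\<^sup>2 * ?r" .
    have r: "?r \<le> Q"
      unfolding Q_def
    proof (rule sum_mono)
      fix i assume i: "i \<in> I"
      have "\<bar>h z' i - h z i\<bar> \<le> 2 * M i" using M[OF z' i] M[OF z(1) i] by linarith
      then show "(h z' i - h z i)\<^sup>2 \<le> (2 * M i)\<^sup>2" by (metis abs_ge_zero power2_abs power_mono)
    qed
    \<comment> \<open>Comparison with the point a fraction \<open>t\<close> of the way to
      \<open>z'\<close>; division by \<open>t\<close> then leaves the directional derivative of the
      penalized objective, up to \<open>\<epsilon>\<close>.\<close>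
    have "f z + k / 2 * q z \<le> (1 - t) * f z + t * f z' + k / 2 * (q z + 2 * t * (?c - q z) + t\<^sup>2 * ?r) + t\<^sup>2"
      using near[OF w(1)] w(2) unfolding \<phi>_def qw by linarith
    then have "0 \<le> t * (f z' - f z + k * (?c - q z) + t * (1 + k / 2 * ?r))"
      by (simp add: algebra_simps power2_eq_square)
    then have "0 \<le> f z' - f z + k * (?c - q z) + t * (1 + k / 2 * ?r)"
      using t by (simp add: zero_le_mult_iff)
    moreover have "t * (1 + k / 2 * ?r) \<le> \<epsilon>"
      using t k r by (intro order_trans[OF _ tQ] mult_left_mono add_left_mono) auto
    moreover have "0 \<le> k * q z" using k q by simp
    ultimately have "?v - 2 * \<epsilon> \<le> f z' + k * ?c" using fz by (simp add: algebra_simps)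
    then show ?thesis by (simp add: sum_distrib_left mult.assoc)
  qed
  then show ?thesis by (intro exI[of _ "\<lambda>i. k * h z i"]) blast
qed

section \<open>Convexity and bounds for the dispatch problem\<close>

lemma convex_combination_bounds:
  fixes t :: real
  assumes "0 \<le> t" "t \<le> 1" "lo \<le> p \<and> p \<le> hi" "lo \<le> q \<and> q \<le> hi"
  shows "lo \<le> (1 - t) * p + t * q" "(1 - t) * p + t * q \<le> hi"
proof -
  have "(1 - t) * lo \<le> (1 - t) * p" "t * lo \<le> t * q" "(1 - t) * p \<le> (1 - t) * hi" "t * q \<le> t * hi"
    using assms by (auto intro!: mult_left_mono)
  then show "lo \<le> (1 - t) * p + t * q" "(1 - t) * p + t * q \<le> hi"
    by (simp_all add: left_diff_distrib)
qed

lemma storage_set_convex: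
  assumes "(u, x) \<in> storage_set T E u_lo u_hi x\<^sub>o" "(u', x') \<in> storage_set T E u_lo u_hi x\<^sub>o" "0 \<le> t" "t \<le> 1"
  shows "(\<lambda>i. (1 - t) * u i + t * u' i, \<lambda>i. (1 - t) * x i + t * x' i) \<in> storage_set T E u_lo u_hi x\<^sub>o"
proof -
  have x: "\<forall>i\<in>{0..T}. 0 \<le> x i \<and> x i \<le> 1" "\<forall>i\<in>{0..T}. 0 \<le> x' i \<and> x' i \<le> 1"
    and u: "\<forall>i\<in>{1..T}. u_lo \<le> u i \<and> u i \<le> u_hi" "\<forall>i\<in>{1..T}. u_lo \<le> u' i \<and> u' i \<le> u_hi"
    and dyn: "\<forall>i\<in>{1..T}. x i = x (i - 1) + u i / E" "\<forall>i\<in>{1..T}. x' i = x' (i - 1) + u' i / E"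
    and ends: "x 0 = x\<^sub>o" "x T = x\<^sub>o" "x' 0 = x\<^sub>o" "x' T = x\<^sub>o"
    using assms(1,2) by (auto simp: storage_set_def)
  have "(1 - t) * x i + t * x' i =
      (1 - t) * x (i - 1) + t * x' (i - 1) + ((1 - t) * u i + t * u' i) / E" if "i \<in> {1..T}" for i
    unfolding bspec[OF dyn(1) that] bspec[OF dyn(2) that] by (simp add: distrib_left add_divide_distrib)
  moreover have "0 \<le> (1 - t) * x i + t * x' i \<and> (1 - t) * x i + t * x' i \<le> 1" if "i \<in> {0..T}" for i
    using convex_combination_bounds[OF assms(3,4), of 0 "x i" 1 "x' i"] x that by auto
  moreover have "u_lo \<le> (1 - t) * u i + t * u' i \<and> (1 - t) * u i + t * u' i \<le> u_hi" if "i \<in> {1..T}" for i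
    using convex_combination_bounds[OF assms(3,4), of u_lo "u i" u_hi "u' i"] u that by auto
  moreover have "(1 - t) * x\<^sub>o + t * x\<^sub>o = x\<^sub>o" by (simp add: left_diff_distrib)
  ultimately show ?thesis
    unfolding storage_set_def using ends by simp
qed

lemma generator_set_convex:
  assumes "g \<in> generator_set T lo hi" "g' \<in> generator_set T lo hi" "0 \<le> t" "t \<le> 1"
  shows "(\<lambda>i. (1 - t) * g i + t * g' i) \<in> generator_set T lo hi"
proof -
  have "lo \<le> (1 - t) * g i + t * g' i \<and> (1 - t) * g i + t * g' i \<le> hi" if "i \<in> {1..T}" for i
    using convex_combination_bounds[OF assms(3,4), of lo "g i" hi "g' i"] assms(1,2) that
    by (auto simp: generator_set_def)
  then show ?thesis unfolding generator_set_def by blast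
qed

lemma generation_cost_convex:
  assumes "0 \<le> \<alpha>" "0 \<le> t" "t \<le> 1"
  shows "generation_cost T \<alpha> \<beta> (\<lambda>i. (1 - t) * g i + t * g' i) \<le>
    (1 - t) * generation_cost T \<alpha> \<beta> g + t * generation_cost T \<alpha> \<beta> g'"
proof -
  have sq: "((1 - t) * p + t * q) * ((1 - t) * p + t * q) \<le> (1 - t) * (p * p) + t * (q * q)" for p q :: real
  proof -
    have "0 \<le> t * (1 - t) * (p - q)\<^sup>2" using assms by simp
    then show ?thesis by (simp add: power2_eq_square algebra_simps)
  qed
  have "(\<Sum>i = 1..T. ((1 - t) * g i + t * g' i) * ((1 - t) * g i + t * g' i)) \<le>
      (\<Sum>i = 1..T. (1 - t) * (g i * g i) + t * (g' i * g' i))"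
    by (intro sum_mono sq)
  then have "\<alpha> * (\<Sum>i = 1..T. ((1 - t) * g i + t * g' i) * ((1 - t) * g i + t * g' i)) \<le>
      \<alpha> * ((1 - t) * (\<Sum>i = 1..T. g i * g i) + t * (\<Sum>i = 1..T. g' i * g' i))"
    using assms(1) by (intro mult_left_mono) (simp_all add: sum.distrib sum_distrib_left)
  moreover have "\<beta> * (\<Sum>i = 1..T. (1 - t) * g i + t * g' i) =
      (1 - t) * (\<beta> * (\<Sum>i = 1..T. g i)) + t * (\<beta> * (\<Sum>i = 1..T. g' i))"
    by (simp add: sum.distrib sum_distrib_left distrib_left mult.left_commute)
  ultimately show ?thesis
    unfolding generation_cost_def by (simp add: distrib_left mult.left_commute)
qed

lemma cycling_cost_nonneg: "1 \<le> T \<Longrightarrow> 0 < a \<Longrightarrow> 0 < B \<Longrightarrow> 0 < E \<Longrightarrow> 0 \<le> cycling_cost T B E a b x"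
  unfolding cycling_cost_def by (intro mult_nonneg_nonneg sum_nonneg) (auto simp: cycle_stress_def)

text \<open>Together with a nonnegative cycling cost this keeps the penalized objective and the
  Lagrangian bounded below.\<close>

lemma generation_cost_lower_bound:
  assumes "0 \<le> \<alpha>" "0 \<le> \<beta>" "g \<in> generator_set T lo hi"
  shows "\<beta> * (real T * lo) \<le> generation_cost T \<alpha> \<beta> g"
proof -
  have "(\<Sum>t = 1..T. lo) \<le> (\<Sum>t = 1..T. g t)"
    using assms(3) by (intro sum_mono) (auto simp: generator_set_def)
  then have "\<beta> * (real T * lo) \<le> \<beta> * (\<Sum>t = 1..T. g t)"
    using assms(2) by (intro mult_left_mono) auto
  moreover have "0 \<le> \<alpha> * (\<Sum>t = 1..T. g t * g t)"
    using assms(1) by (intro mult_nonneg_nonneg[OF _ sum_nonneg]) auto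
  ultimately show ?thesis by (simp add: generation_cost_def)
qed

text \<open>Lower semicontinuity, at zero imbalance, of the optimal value under perturbation of the
  balance constraint. Otherwise points of cost below \<open>v - \<epsilon>\<close> with imbalance
  tending to 0 would, by compactness, accumulate at a balanced feasible point whose cost, by
  continuity, is at most \<open>v - \<epsilon>\<close>.\<close>

lemma cost_lower_semicontinuous:
  fixes D :: "nat \<Rightarrow> real"
  assumes "1 \<le> T" "0 < E" "0 < B" "0 < a" "1 < b" "0 < \<epsilon>"
    and opt: "\<forall>g u x. g \<in> generator_set T g_lo g_hi \<longrightarrow> (u, x) \<in> storage_set T E u_lo u_hi x\<^sub>o \<longrightarrow>
      (\<forall>t\<in>{1..T}. D t + u t = g t) \<longrightarrow> v \<le> generation_cost T \<alpha> \<beta> g + cycling_cost T B E a b x"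
  shows "\<exists>\<eta>>0. \<forall>g u x. g \<in> generator_set T g_lo g_hi \<longrightarrow> (u, x) \<in> storage_set T E u_lo u_hi x\<^sub>o \<longrightarrow>
      (\<forall>t\<in>{1..T}. \<bar>D t + u t - g t\<bar> \<le> \<eta>) \<longrightarrow>
      v - \<epsilon> \<le> generation_cost T \<alpha> \<beta> g + cycling_cost T B E a b x"
proof (rule ccontr)
  assume neg: "\<not> ?thesis"
  have "\<exists>g u x. g \<in> generator_set T g_lo g_hi \<and> (u, x) \<in> storage_set T E u_lo u_hi x\<^sub>o \<and>
      (\<forall>t\<in>{1..T}. \<bar>D t + u t - g t\<bar> \<le> inverse (real (Suc n))) \<and>
      generation_cost T \<alpha> \<beta> g + cycling_cost T B E a b x < v - \<epsilon>" for n
  proof -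
    have "0 < inverse (real (Suc n))" by simp
    with neg show ?thesis by (meson not_le)
  qed
  then obtain g u x where g: "\<And>n. g n \<in> generator_set T g_lo g_hi"
    and ux: "\<And>n. (u n, x n) \<in> storage_set T E u_lo u_hi x\<^sub>o"
    and gap: "\<And>n t. t \<in> {1..T} \<Longrightarrow> \<bar>D t + u n t - g n t\<bar> \<le> inverse (real (Suc n))"
    and low: "\<And>n. generation_cost T \<alpha> \<beta> (g n) + cycling_cost T B E a b (x n) < v - \<epsilon>"
    by metis
  have xb: "0 \<le> x n t \<and> x n t \<le> 1" if "t \<le> T" for n t
    using ux[of n] that by (auto simp: storage_set_def)
  have gb: "g_lo \<le> g n t \<and> g n t \<le> g_hi" if "t \<in> {1..T}" for n t
    using g[of n] that by (auto simp: generator_set_def)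
  have ub: "u_lo \<le> u n t \<and> u n t \<le> u_hi \<and> x n t = x n (t - 1) + u n t / E" if "t \<in> {1..T}" for n t
    using ux[of n] that by (auto simp: storage_set_def)
  have "\<bar>x n t\<bar> \<le> 1" if "t \<in> {..T}" for n t using xb[of t n] that by auto
  then obtain r x' where r: "strict_mono r" and x': "\<And>t. t \<le> T \<Longrightarrow> (\<lambda>n. x (r n) t) \<longlonglongrightarrow> x' t"
    using bounded_coordinates_subsequence[of "{..T}" x "\<lambda>_. 1"] by (metis atMost_iff finite_atMost)
  have "\<bar>g (r n) t\<bar> \<le> max \<bar>g_lo\<bar> \<bar>g_hi\<bar>" if "t \<in> {1..T}" for n t using gb[of t "r n"] that by auto
  then obtain s g' where s: "strict_mono s" and g': "\<And>t. t \<in> {1..T} \<Longrightarrow> (\<lambda>n. g (r (s n)) t) \<longlonglongrightarrow> g' t"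
    using bounded_coordinates_subsequence[of "{1..T}" "\<lambda>n. g (r n)" "\<lambda>_. max \<bar>g_lo\<bar> \<bar>g_hi\<bar>"]
    by (metis finite_atLeastAtMost)
  define q where "q = (\<lambda>n. r (s n))"
  have q: "strict_mono q" using strict_mono_o[OF r s] by (simp add: q_def o_def)
  have gq: "(\<lambda>n. g (q n) t) \<longlonglongrightarrow> g' t" if "t \<in> {1..T}" for t using g'[OF that] by (simp add: q_def)
  have xq: "(\<lambda>n. x (q n) t) \<longlonglongrightarrow> x' t" if "t \<le> T" for t
    using LIMSEQ_subseq_LIMSEQ[OF x'[OF that] s] by (simp add: q_def o_def)
  \<comment> \<open>The dynamics determine \<open>u\<close> from \<open>x\<close>, so the powers
    converge along the same subsequence.\<close>
  define u' where "u' t = E * (x' t - x' (t - 1))" for t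
  have uq: "(\<lambda>n. u (q n) t) \<longlonglongrightarrow> u' t" if t: "t \<in> {1..T}" for t
  proof -
    have "u (q n) t = E * (x (q n) t - x (q n) (t - 1))" for n
      using ub[OF t, of "q n"] \<open>0 < E\<close> by (simp add: field_simps)
    then show ?thesis unfolding u'_def using t by (auto intro!: tendsto_intros xq)
  qed
  have x'b: "0 \<le> x' t \<and> x' t \<le> 1" if "t \<le> T" for t
    using LIMSEQ_le_const[OF xq[OF that], of 0] LIMSEQ_le_const2[OF xq[OF that], of 1] xb[OF that] by blast
  have bounds: "lo \<le> l \<and> l \<le> hi" if "f \<longlonglongrightarrow> l" "\<And>n. lo \<le> f n \<and> f n \<le> hi" for f :: "nat \<Rightarrow> real" and l lo hi
    using LIMSEQ_le_const[OF that(1), of lo] LIMSEQ_le_const2[OF that(1), of hi] that(2) by blast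
  have x'e: "x' t = x\<^sub>o" if "t \<in> {0, T}" for t
  proof -
    have "x n t = x\<^sub>o" for n using ux[of n] that by (auto simp: storage_set_def)
    then show ?thesis using LIMSEQ_unique[OF xq[of t], of x\<^sub>o] that by auto
  qed
  have "g' \<in> generator_set T g_lo g_hi"
    unfolding generator_set_def using bounds[OF gq gb] by blast
  moreover have "(u', x') \<in> storage_set T E u_lo u_hi x\<^sub>o"
    unfolding storage_set_def using x'b x'e bounds[OF uq, of _ u_lo u_hi] ub \<open>0 < E\<close> by (auto simp: u'_def)
  moreover have "D t + u' t = g' t" if t: "t \<in> {1..T}" for t
  proof -
    have "(\<lambda>n. D t + u (q n) t - g (q n) t) \<longlonglongrightarrow> D t + u' t - g' t"
      by (intro tendsto_intros uq gq t)
    moreover have "(\<lambda>n. D t + u (q n) t - g (q n) t) \<longlonglongrightarrow> 0"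
    proof (rule Lim_null_comparison)
      show "\<forall>\<^sub>F n in sequentially. norm (D t + u (q n) t - g (q n) t) \<le> inverse (real (Suc (q n)))"
        using gap[OF t] by simp
      show "(\<lambda>n. inverse (real (Suc (q n)))) \<longlonglongrightarrow> 0"
        using LIMSEQ_subseq_LIMSEQ[OF LIMSEQ_inverse_real_of_nat q] by (simp add: o_def)
    qed
    ultimately show ?thesis using LIMSEQ_unique by fastforce
  qed
  ultimately have "v \<le> generation_cost T \<alpha> \<beta> g' + cycling_cost T B E a b x'"
    using opt by blast
  moreover have "(\<lambda>n. generation_cost T \<alpha> \<beta> (g (q n)) + cycling_cost T B E a b (x (q n))) \<longlonglongrightarrow>
      generation_cost T \<alpha> \<beta> g' + cycling_cost T B E a b x'"
  proof (rule tendsto_add)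
    show "(\<lambda>n. generation_cost T \<alpha> \<beta> (g (q n))) \<longlonglongrightarrow> generation_cost T \<alpha> \<beta> g'"
      unfolding generation_cost_def by (intro tendsto_intros gq)
    \<comment> \<open>The total deviation bounds every coordinate at once and still tends to
      0.\<close>
    define e where "e n = (\<Sum>t\<le>T. \<bar>x (q n) t - x' t\<bar>)" for n
    have "e \<longlonglongrightarrow> (\<Sum>t\<le>T. \<bar>x' t - x' t\<bar>)"
      unfolding e_def by (intro tendsto_intros xq) auto
    then have "(\<lambda>n. B * E * (cycle_stress a b 2 * (2 * real T * e n))) \<longlonglongrightarrow> B * E * (cycle_stress a b 2 * (2 * real T * 0))"
      by (intro tendsto_intros) simp
    then have e0: "(\<lambda>n. B * E * (cycle_stress a b 2 * (2 * real T * e n))) \<longlonglongrightarrow> 0" by simp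
    have "\<bar>cycling_cost T B E a b (x (q n)) - cycling_cost T B E a b x'\<bar> \<le>
        B * E * (cycle_stress a b 2 * (2 * real T * e n))" for n
    proof (rule cycling_cost_lipschitz[OF assms(1,4,5,3,2) xb x'b])
      show "\<bar>x (q n) i - x' i\<bar> \<le> e n" if "i \<le> T" for i
        unfolding e_def using that by (intro member_le_sum[where f = "\<lambda>t. \<bar>x (q n) t - x' t\<bar>"]) auto
    qed
    then have "(\<lambda>n. cycling_cost T B E a b (x (q n)) - cycling_cost T B E a b x') \<longlonglongrightarrow> 0"
      by (intro Lim_null_comparison[OF _ e0]) simp
    then show "(\<lambda>n. cycling_cost T B E a b (x (q n))) \<longlonglongrightarrow> cycling_cost T B E a b x'"
      by (simp add: LIM_zero_iff)
  qed
  then have "generation_cost T \<alpha> \<beta> g' + cycling_cost T B E a b x' \<le> v - \<epsilon>"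
    by (rule LIMSEQ_le_const2) (use low in \<open>auto intro: less_imp_le\<close>)
  ultimately show False using \<open>0 < \<epsilon>\<close> by simp
qed

section \<open>Zero duality gap and separation of the Lagrangian\<close>

theorem theorem2:
  fixes T :: nat and \<alpha>\<^sub>g \<beta>\<^sub>g g_lo g_hi E u_lo u_hi x\<^sub>o B \<alpha>\<^sub>b \<beta>\<^sub>b :: real
    and D g_opt u_opt x_opt l_opt p :: "nat \<Rightarrow> real"
  assumes "T \<ge> 1"
    and "\<alpha>\<^sub>g > 0" and "\<beta>\<^sub>g > 0" and "g_lo \<le> g_hi"
    and "E > 0" and "u_lo \<le> u_hi" and "0 \<le> x\<^sub>o" and "x\<^sub>o \<le> 1"
    and "B > 0" and "\<alpha>\<^sub>b > 0" and "\<beta>\<^sub>b > 1"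
    and primal_optimal:
      "is_arg_min (\<lambda>(g, u, x). generation_cost T \<alpha>\<^sub>g \<beta>\<^sub>g g + cycling_cost T B E \<alpha>\<^sub>b \<beta>\<^sub>b x)
         (\<lambda>(g, u, x). g \<in> generator_set T g_lo g_hi \<and> (u, x) \<in> storage_set T E u_lo u_hi x\<^sub>o \<and>
            (\<forall>t\<in>{1..T}. D t + u t = g t))
         (g_opt, u_opt, x_opt)"
    and dual_optimal:
      "is_arg_max (dual_function T \<alpha>\<^sub>g \<beta>\<^sub>g g_lo g_hi D E u_lo u_hi x\<^sub>o B \<alpha>\<^sub>b \<beta>\<^sub>b) (\<lambda>l. True) l_opt"
    and prices: "p = l_opt"
  shows "is_arg_max (\<lambda>g. (\<Sum>t = 1..T. p t * g t) - generation_cost T \<alpha>\<^sub>g \<beta>\<^sub>g g)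
           (\<lambda>g. g \<in> generator_set T g_lo g_hi) g_opt \<and>
         is_arg_max (\<lambda>(u, x). - (\<Sum>t = 1..T. p t * u t) - cycling_cost T B E \<alpha>\<^sub>b \<beta>\<^sub>b x)
           (\<lambda>(u, x). (u, x) \<in> storage_set T E u_lo u_hi x\<^sub>o) (u_opt, x_opt)"
proof -
  let ?G = "generator_set T g_lo g_hi" and ?S = "storage_set T E u_lo u_hi x\<^sub>o"
  let ?cg = "generation_cost T \<alpha>\<^sub>g \<beta>\<^sub>g" and ?cs = "cycling_cost T B E \<alpha>\<^sub>b \<beta>\<^sub>b"
  let ?dual = "dual_function T \<alpha>\<^sub>g \<beta>\<^sub>g g_lo g_hi D E u_lo u_hi x\<^sub>o B \<alpha>\<^sub>b \<beta>\<^sub>b"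
  define K where "K = {(g, u, x). g \<in> ?G \<and> (u, x) \<in> ?S}"
  define f where "f = (\<lambda>(g, u :: nat \<Rightarrow> real, x). ?cg g + ?cs x)"
  define h where "h = (\<lambda>(g, u, x :: nat \<Rightarrow> real) t. D t + u t - (g t :: real))"
  define Lag where "Lag l z = f z + (\<Sum>t = 1..T. l t * h z t)" for l z
  define z\<^sub>0 where "z\<^sub>0 = (g_opt, u_opt, x_opt)"
  define M where "M t = \<bar>D t\<bar> + max \<bar>u_lo\<bar> \<bar>u_hi\<bar> + max \<bar>g_lo\<bar> \<bar>g_hi\<bar>" for t
  define m where "m = \<beta>\<^sub>g * (real T * g_lo)"
  note opt = primal_optimal[unfolded is_arg_min_linorder]
  have opt_feasible: "g_opt \<in> ?G" "(u_opt, x_opt) \<in> ?S" "\<And>t. t \<in> {1..T} \<Longrightarrow> D t + u_opt t = g_opt t"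
    using conjunct1[OF opt] by auto
  have opt_le: "\<forall>g u x. g \<in> ?G \<longrightarrow> (u, x) \<in> ?S \<longrightarrow> (\<forall>t\<in>{1..T}. D t + u t = g t) \<longrightarrow> f z\<^sub>0 \<le> ?cg g + ?cs x"
    using conjunct2[OF opt] by (simp add: f_def z\<^sub>0_def)
  have z0: "z\<^sub>0 \<in> K" "\<And>t. t \<in> {1..T} \<Longrightarrow> h z\<^sub>0 t = 0"
    using opt_feasible by (auto simp: K_def z\<^sub>0_def h_def)
  have m: "m \<le> f z" if "z \<in> K" for z
    using that generation_cost_lower_bound[of \<alpha>\<^sub>g \<beta>\<^sub>g _ T g_lo g_hi] cycling_cost_nonneg[of T \<alpha>\<^sub>b B E \<beta>\<^sub>b] assms(1-11)
    by (auto simp: K_def f_def m_def intro!: add_increasing2)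
  have M: "\<bar>h z t\<bar> \<le> M t" if "z \<in> K" "t \<in> {1..T}" for z t
  proof -
    obtain g u x where z: "z = (g, u, x)" by (cases z)
    have "g_lo \<le> g t" "g t \<le> g_hi" "u_lo \<le> u t" "u t \<le> u_hi"
      using that by (auto simp: z K_def generator_set_def storage_set_def)
    then show ?thesis by (auto simp: z h_def M_def)
  qed
  \<comment> \<open>Convexity enters only through the values of \<open>f\<close> and
    \<open>h\<close>, so no linear structure on the triples is involved.\<close>
  have mix: "\<exists>w\<in>K. f w \<le> (1 - t) * f z + t * f z' \<and> (\<forall>i\<in>{1..T}. h w i = (1 - t) * h z i + t * h z' i)"
    if zK: "z \<in> K" "z' \<in> K" and t: "0 \<le> t" "t \<le> 1" for z z' t
  proof -
    obtain g u x g' u' x' where z: "z = (g, u, x)" "z' = (g', u', x')" by (cases z, cases z')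
    have gs: "g \<in> ?G" "g' \<in> ?G" "(u, x) \<in> ?S" "(u', x') \<in> ?S" using zK by (auto simp: z K_def)
    let ?c = "\<lambda>p q i. (1 - t) * p i + t * q i :: real"
    have "?cs (?c x x') \<le> (1 - t) * ?cs x + t * ?cs x'"
      using gs(3,4) by (intro cycling_cost_convex assms(1,5,9-11) t) (auto simp: storage_set_def)
    moreover have "?cg (?c g g') \<le> (1 - t) * ?cg g + t * ?cg g'"
      using assms(2) t by (intro generation_cost_convex) auto
    ultimately have "f (?c g g', ?c u u', ?c x x') \<le> (1 - t) * f z + t * f z'"
      by (simp add: f_def z distrib_left)
    moreover have "(?c g g', ?c u u', ?c x x') \<in> K"
      using storage_set_convex[OF gs(3,4) t] generator_set_convex[OF gs(1,2) t] by (simp add: K_def)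
    moreover have "h (?c g g', ?c u u', ?c x x') i = (1 - t) * h z i + t * h z' i" for i
      by (simp add: h_def z algebra_simps)
    ultimately show ?thesis by blast
  qed
  have dual: "?dual l = Inf (Lag l ` K)" for l
    unfolding dual_function_def
    by (rule arg_cong[of _ _ Inf]) (force simp: Lag_def K_def f_def h_def)
  \<comment> \<open>\<open>Inf\<close> on the reals is a lower bound only for sets that are bounded
    below; here the imbalance, and with it the multiplier term, is bounded on
    \<open>K\<close>.\<close>
  have bdd: "bdd_below (Lag l ` K)" for l
  proof (rule bdd_belowI2)
    fix z assume z: "z \<in> K"
    have "- (\<bar>l t\<bar> * M t) \<le> l t * h z t" if "t \<in> {1..T}" for t
    proof -
      have "\<bar>l t * h z t\<bar> \<le> \<bar>l t\<bar> * M t" unfolding abs_mult using M[OF z that] by (intro mult_left_mono) auto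
      then show ?thesis by linarith
    qed
    then have "(\<Sum>t = 1..T. - (\<bar>l t\<bar> * M t)) \<le> (\<Sum>t = 1..T. l t * h z t)" by (rule sum_mono)
    then show "m + (\<Sum>t = 1..T. - (\<bar>l t\<bar> * M t)) \<le> Lag l z"
      using m[OF z] by (simp add: Lag_def)
  qed
  \<comment> \<open>The approximate multiplier depends on \<open>\<epsilon>\<close>. Dual optimality
    transfers each of these bounds to the single multiplier \<open>l_opt\<close>, so no limit of
    multipliers has to be formed.\<close>
  have no_gap: "f z\<^sub>0 - 2 * \<epsilon> \<le> ?dual l_opt" if "0 < \<epsilon>" for \<epsilon>
  proof -
    obtain \<eta> where "0 < \<eta>" and \<eta>: "\<And>g u x. g \<in> ?G \<Longrightarrow> (u, x) \<in> ?S \<Longrightarrow>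
        \<forall>t\<in>{1..T}. \<bar>D t + u t - g t\<bar> \<le> \<eta> \<Longrightarrow> f z\<^sub>0 - \<epsilon> \<le> ?cg g + ?cs x"
      using cost_lower_semicontinuous[OF assms(1,5,9,10,11) \<open>0 < \<epsilon>\<close> opt_le] by blast
    have lsc: "f z\<^sub>0 - \<epsilon> \<le> f z" if "z \<in> K" "\<forall>t\<in>{1..T}. \<bar>h z t\<bar> \<le> \<eta>" for z
      using that \<eta> by (auto simp: K_def h_def f_def)
    obtain l where "\<And>z. z \<in> K \<Longrightarrow> f z\<^sub>0 - 2 * \<epsilon> \<le> Lag l z"
      using approximate_multiplier[OF finite_atLeastAtMost mix m M z0 \<open>0 < \<epsilon>\<close> \<open>0 < \<eta>\<close> lsc]
      unfolding Lag_def by blast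
    then have "f z\<^sub>0 - 2 * \<epsilon> \<le> ?dual l"
      unfolding dual using z0(1) by (intro cInf_greatest) auto
    also have "\<dots> \<le> ?dual l_opt"
      using dual_optimal by (auto simp: is_arg_max_def not_less)
    finally show ?thesis .
  qed
  have "f z\<^sub>0 \<le> ?dual l_opt"
    by (rule field_le_epsilon) (use no_gap[of "e / 2" for e] in force)
  also have "?dual l_opt \<le> Lag l_opt z" if "z \<in> K" for z
    unfolding dual using that by (intro cInf_lower bdd) auto
  finally have saddle: "f z\<^sub>0 \<le> Lag p z" if "z \<in> K" for z
    using that prices by blast
  have split: "Lag p (g, u, x) = (\<Sum>t = 1..T. p t * D t) + (?cg g - (\<Sum>t = 1..T. p t * g t)) +
      (?cs x + (\<Sum>t = 1..T. p t * u t))" for g u x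
    by (simp add: Lag_def f_def h_def algebra_simps sum.distrib sum_subtractf)
  have "Lag p z\<^sub>0 = f z\<^sub>0" using z0(2) by (simp add: Lag_def)
  then have min: "Lag p (g_opt, u_opt, x_opt) \<le> Lag p (g, u, x)" if "g \<in> ?G" "(u, x) \<in> ?S" for g u x
    using saddle[of "(g, u, x)"] that by (simp add: K_def z\<^sub>0_def)
  \<comment> \<open>Keeping the storage block at its optimum, the storage terms of
    \<open>split\<close> cancel and the generator comparison remains; the other subproblem is
    symmetric.\<close>
  have "(\<Sum>t = 1..T. p t * g t) - ?cg g \<le> (\<Sum>t = 1..T. p t * g_opt t) - ?cg g_opt" if "g \<in> ?G" for g
    using min[OF that opt_feasible(2)] unfolding split by linarith
  moreover have "- (\<Sum>t = 1..T. p t * u t) - ?cs x \<le> - (\<Sum>t = 1..T. p t * u_opt t) - ?cs x_opt"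
    if "(u, x) \<in> ?S" for u x
    using min[OF opt_feasible(1) that] unfolding split by linarith
  ultimately show ?thesis
    using opt_feasible(1,2) unfolding is_arg_max_def by (auto simp: not_less)
qed

end
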